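(* Let $G$ be a finitely generated contracting self-similar group. Then the word problem of $G$ can be solved in $\mathsf{LOGSPACE}$ (deterministic logarithmic space).
   Context: Let $X$ be a finite set and $W$ the automorphism group of the regular rooted tree with vertex set $X^*$ (edges between $v$ and $vx$ for $v\in X^*$, $x\in X$), acting on the right. For $g\in W$ let $\pi\in\mathrm{Sym}(X)$ be the restriction of $g$ to $X$, and for $x\in X$ let $g@x\in W$ be defined by $(xv)^g=x^{\pi}v^{g@x}$ for all $v\in X^*$; for $v=x_1\cdots x_n\in X^*$ put $g@v=g@x_1\cdots@x_n$ (iterated states). A subgroup $G\le W$ is self-similar if $g@x\in G$ for all $g\in G$, $x\in X$. A self-similar group $G$ is contracting if there is a finite subset $N\subseteq G$ such that for all $g\in G$ we have $g@v\in N$ whenever $v\in X^*$ is long enough (depending on $g$). The word problem of a finitely generated group $G$ with finite standard generating set $\Sigma=S\cup S^{-1}\cup\{1\}$ ($S$ a finite generating set) is: given a word $w\in\Sigma^*$, does $w$ represent the identity of $G$? *)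

theory Defs
  imports
    "HOL-Algebra.Generated_Groups"
    "HOL-Combinatorics.Permutations"
    "HOL-Library.Landau_Symbols"
    Complex_Main
begin

text \<open>Vertices of the regular rooted tree over \<open>X\<close> are the elements of \<open>lists X\<close>, the root
  is \<open>[]\<close>, and \<open>x # v\<close> is the word \<open>xv\<close>.\<close>

definition tree_edge :: "'x set \<Rightarrow> 'x list \<Rightarrow> 'x list \<Rightarrow> bool" where
  "tree_edge X u v \<longleftrightarrow> (\<exists>x\<in>X. v = u @ [x]) \<or> (\<exists>x\<in>X. u = v @ [x])"

text \<open>An automorphism is made a total function by letting it fix all lists that are not vertices
  (this is part of \<open>permutes\<close>). Groups act on the right, so \<open>g \<otimes> h\<close> is \<open>g\<close> followed by \<open>h\<close>.\<close>

definition tree_aut :: "'x set \<Rightarrow> ('x list \<Rightarrow> 'x list) monoid" where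
  "tree_aut X =
    \<lparr>carrier = {g. g permutes lists X \<and> g [] = [] \<and>
        (\<forall>u\<in>lists X. \<forall>v\<in>lists X. tree_edge X (g u) (g v) \<longleftrightarrow> tree_edge X u v)},
     monoid.mult = (\<lambda>g h. h \<circ> g),
     one = id\<rparr>"

text \<open>The state \<open>g@x\<close>: since \<open>g\<close> preserves levels and prefixes, it is obtained by removing the
  first letter of the image of \<open>xv\<close>; see \<open>tree_aut_Cons\<close> and \<open>state_closed\<close> below.\<close>

definition state :: "'x set \<Rightarrow> ('x list \<Rightarrow> 'x list) \<Rightarrow> 'x \<Rightarrow> ('x list \<Rightarrow> 'x list)" where
  "state X g x = (\<lambda>v. if v \<in> lists X then tl (g (x # v)) else v)"

definition states :: "'x set \<Rightarrow> ('x list \<Rightarrow> 'x list) \<Rightarrow> 'x list \<Rightarrow> ('x list \<Rightarrow> 'x list)" where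
  "states X = foldl (state X)"

definition self_similar :: "'x set \<Rightarrow> ('x list \<Rightarrow> 'x list) set \<Rightarrow> bool" where
  "self_similar X G \<longleftrightarrow> subgroup G (tree_aut X) \<and> (\<forall>g\<in>G. \<forall>x\<in>X. state X g x \<in> G)"

definition contracting :: "'x set \<Rightarrow> ('x list \<Rightarrow> 'x list) set \<Rightarrow> bool" where
  "contracting X G \<longleftrightarrow>
    (\<exists>N. finite N \<and> N \<subseteq> G \<and>
      (\<forall>g\<in>G. \<exists>n. \<forall>v\<in>lists X. length v \<ge> n \<longrightarrow> states X g v \<in> N))"

lemma tree_autD:
  assumes "g \<in> carrier (tree_aut X)"
  shows "g permutes lists X" "g [] = []"
    "\<lbrakk>u \<in> lists X; v \<in> lists X\<rbrakk> \<Longrightarrow> tree_edge X (g u) (g v) \<longleftrightarrow> tree_edge X u v"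
  using assms by (auto simp: tree_aut_def)

lemma group_tree_aut: "group (tree_aut X)"
proof (rule groupI)
  show "\<exists>y\<in>carrier (tree_aut X). y \<otimes>\<^bsub>tree_aut X\<^esub> g = \<one>\<^bsub>tree_aut X\<^esub>"
    if g: "g \<in> carrier (tree_aut X)" for g
  proof
    note p = tree_autD(1)[OF g]
    have in_lists: "inv_into UNIV g v \<in> lists X" if "v \<in> lists X" for v
      using permutes_in_image[OF permutes_inv[OF p]] that by blast
    have "tree_edge X (inv_into UNIV g u) (inv_into UNIV g v) \<longleftrightarrow> tree_edge X u v"
      if "u \<in> lists X" "v \<in> lists X" for u v
      using tree_autD(3)[OF g in_lists[OF that(1)] in_lists[OF that(2)]]
      by (simp add: permutes_inverses(1)[OF p])
    moreover have "inv_into UNIV g [] = []"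
      using permutes_inverses(2)[OF p, of "[]"] tree_autD(2)[OF g] by simp
    ultimately show "inv_into UNIV g \<in> carrier (tree_aut X)"
      using permutes_inv[OF p] by (simp add: tree_aut_def)
    show "inv_into UNIV g \<otimes>\<^bsub>tree_aut X\<^esub> g = \<one>\<^bsub>tree_aut X\<^esub>"
      using permutes_inv_o(1)[OF p] by (simp add: tree_aut_def)
  qed
qed (auto simp: tree_aut_def permutes_id permutes_in_image intro: permutes_compose)

lemma tree_aut_snoc:
  assumes g: "g \<in> carrier (tree_aut X)" and "v \<in> lists X" "x \<in> X"
  shows "\<exists>y\<in>X. g (v @ [x]) = g v @ [y]"
  using assms(2,3)
proof (induction v arbitrary: x rule: rev_induct)
  case Nil
  then have "tree_edge X (g []) (g [x])"
    using tree_autD(3)[OF g, of "[]" "[x]"] by (auto simp: tree_edge_def)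
  then show ?case by (auto simp: tree_edge_def tree_autD(2)[OF g])
next
  case (snoc z u)
  then have u: "u \<in> lists X" "z \<in> X" by auto
  obtain y where y: "g (u @ [z]) = g u @ [y]" using snoc.IH[OF u] by blast
  have "tree_edge X (u @ [z]) ((u @ [z]) @ [x])" using snoc.prems by (auto simp: tree_edge_def)
  then have e: "tree_edge X (g (u @ [z])) (g ((u @ [z]) @ [x]))"
    using tree_autD(3)[OF g, of "u @ [z]" "(u @ [z]) @ [x]"] snoc.prems by auto
  show ?case
  proof (rule ccontr)
    assume "\<not> ?case"
    with e y have "g u = g ((u @ [z]) @ [x])" by (auto simp: tree_edge_def)
    then show False using permutes_inj[OF tree_autD(1)[OF g]] by (auto dest: injD)
  qed
qed

lemma tree_aut_append:
  assumes g: "g \<in> carrier (tree_aut X)" and "v \<in> lists X" "w \<in> lists X"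
  shows "\<exists>w'\<in>lists X. length w' = length w \<and> g (v @ w) = g v @ w'"
  using assms(3)
proof (induction w rule: rev_induct)
  case (snoc x w)
  then obtain w' where w': "w' \<in> lists X" "length w' = length w" "g (v @ w) = g v @ w'" by auto
  obtain y where "y \<in> X" "g ((v @ w) @ [x]) = g (v @ w) @ [y]"
    using tree_aut_snoc[OF g, of "v @ w" x] snoc.prems assms(2) by auto
  with w' show ?case by (intro bexI[of _ "w' @ [y]"]) auto
qed simp

text \<open>The defining equation \<open>(xv)\<^sup>g = x\<^sup>\<pi> v\<^sup>g\<^sup>@\<^sup>x\<close>.\<close>

lemma tree_aut_Cons:
  assumes g: "g \<in> carrier (tree_aut X)" and "x \<in> X" "v \<in> lists X"
  shows "g (x # v) = g [x] @ state X g x v" "length (g [x]) = 1"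
proof -
  obtain y where y: "g [x] = [y]"
    using tree_aut_snoc[OF g, of "[]" x] assms tree_autD(2)[OF g] by auto
  then show "length (g [x]) = 1" by simp
  show "g (x # v) = g [x] @ state X g x v"
    using tree_aut_append[OF g, of "[x]" v] assms y by (auto simp: state_def)
qed

lemma state_closed:
  assumes g: "g \<in> carrier (tree_aut X)" and x: "x \<in> X"
  shows "state X g x \<in> carrier (tree_aut X)"
proof -
  let ?h = "state X g x"
  note p = tree_autD(1)[OF g]
  obtain y where y: "g [x] = [y]" "y \<in> X"
    using tree_aut_snoc[OF g, of "[]" x] x tree_autD(2)[OF g] by auto
  have eq: "g (x # v) = y # ?h v" if "v \<in> lists X" for v
    using tree_aut_Cons(1)[OF g x that] y by simp
  have closed: "?h v \<in> lists X" if "v \<in> lists X" for v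
    using permutes_in_image[OF p, of "x # v"] eq[OF that] that x by auto
  have inj: "inj_on ?h (lists X)"
    by (rule inj_onI) (metis eq injD list.inject permutes_inj[OF p])
  have surj: "w \<in> ?h ` lists X" if w: "w \<in> lists X" for w
  proof -
    have "y # w \<in> lists X" using w y by auto
    then obtain u where u: "u \<in> lists X" "g u = y # w"
      using permutes_image[OF p] by (metis image_iff)
    then obtain x' v where xv: "u = x' # v" "x' \<in> X" "v \<in> lists X"
      using tree_autD(2)[OF g] by (cases u) auto
    have "g [x'] = [y]"
      using tree_aut_Cons[OF g xv(2,3)] u xv(1) by (cases "g [x']") auto
    then have "x' = x" using y injD[OF permutes_inj[OF p], of "[x']" "[x]"] by simp
    then show ?thesis using u xv eq[OF xv(3)] by auto
  qed
  have "bij_betw ?h (lists X) (lists X)"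
    using inj surj closed by (auto simp: bij_betw_def)
  then have "?h permutes lists X" by (rule bij_imp_permutes) (simp add: state_def)
  moreover have "?h [] = []" using y by (simp add: state_def)
  moreover have "tree_edge X (?h u) (?h v) \<longleftrightarrow> tree_edge X u v"
    if "u \<in> lists X" "v \<in> lists X" for u v
  proof -
    have "tree_edge X (z # a) (z # b) \<longleftrightarrow> tree_edge X a b" for z a b
      by (auto simp: tree_edge_def)
    then show ?thesis
      using tree_autD(3)[OF g, of "x # u" "x # v"] that x eq by simp
  qed
  ultimately show ?thesis by (simp add: tree_aut_def)
qed

text \<open>Turing machines with a two-way read-only input tape, whose word is delimited by end
  markers, and one read-write work tape, infinite to the right. Control states and work symbols
  are natural numbers; \<open>wf_tm\<close> restricts them to finite sets.\<close>

datatype 'a input_symbol = Left_End | Letter 'a | Right_End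

datatype move = Move_Left | Stay | Move_Right

record 'a tm =
  control :: "nat set"
  work_alphabet :: "nat set"
  blank :: nat
  start :: nat
  accept :: nat
  reject :: nat
  delta :: "nat \<Rightarrow> 'a input_symbol \<Rightarrow> nat \<Rightarrow> nat \<times> nat \<times> move \<times> move"

definition wf_tm :: "'a set \<Rightarrow> 'a tm \<Rightarrow> bool" where
  "wf_tm A M \<longleftrightarrow>
    finite A \<and> finite (control M) \<and> finite (work_alphabet M) \<and>
    blank M \<in> work_alphabet M \<and> {start M, accept M, reject M} \<subseteq> control M \<and>
    accept M \<noteq> reject M \<and>
    (\<forall>q \<in> control M. \<forall>a \<in> {Left_End, Right_End} \<union> Letter ` A. \<forall>c \<in> work_alphabet M.
      \<forall>q' c' d e. delta M q a c = (q', c', d, e) \<longrightarrow> q' \<in> control M \<and> c' \<in> work_alphabet M)"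

record config =
  ctrl :: nat
  in_pos :: nat
  work_pos :: nat
  work :: "nat \<Rightarrow> nat"

definition init_config :: "'a tm \<Rightarrow> config" where
  "init_config M = \<lparr>ctrl = start M, in_pos = 0, work_pos = 0, work = (\<lambda>_. blank M)\<rparr>"

definition read_input :: "'a list \<Rightarrow> nat \<Rightarrow> 'a input_symbol" where
  "read_input w i =
    (if i = 0 then Left_End else if i \<le> length w then Letter (w ! (i - 1)) else Right_End)"

text \<open>A head at the left end of its tape stays there when told to move left.\<close>

fun move_head :: "move \<Rightarrow> nat \<Rightarrow> nat" where
  "move_head Move_Left i = i - 1"
| "move_head Stay i = i"
| "move_head Move_Right i = i + 1"

definition halted :: "'a tm \<Rightarrow> config \<Rightarrow> bool" where
  "halted M c \<longleftrightarrow> ctrl c \<in> {accept M, reject M}"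

text \<open>The input head is confined to the word and its two end markers; otherwise its position
  would be unbounded storage that the space bound does not count.\<close>

definition tm_step :: "'a tm \<Rightarrow> 'a list \<Rightarrow> config \<Rightarrow> config" where
  "tm_step M w c =
    (if halted M c then c
     else case delta M (ctrl c) (read_input w (in_pos c)) (work c (work_pos c)) of
       (q, b, d, e) \<Rightarrow>
         \<lparr>ctrl = q,
          in_pos = min (length w + 1) (move_head d (in_pos c)),
          work_pos = move_head e (work_pos c),
          work = (work c)(work_pos c := b)\<rparr>)"

definition tm_run :: "'a tm \<Rightarrow> 'a list \<Rightarrow> nat \<Rightarrow> config" where
  "tm_run M w t = (tm_step M w ^^ t) (init_config M)"

definition decides :: "'a set \<Rightarrow> 'a tm \<Rightarrow> 'a list set \<Rightarrow> bool" where
  "decides A M L \<longleftrightarrow> L \<subseteq> lists A \<and>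
    (\<forall>w\<in>lists A. (\<exists>t. halted M (tm_run M w t)) \<and>
      ((\<exists>t. ctrl (tm_run M w t) = accept M) \<longleftrightarrow> w \<in> L))"

definition space_bounded :: "'a set \<Rightarrow> 'a tm \<Rightarrow> (nat \<Rightarrow> nat) \<Rightarrow> bool" where
  "space_bounded A M s \<longleftrightarrow>
    (\<forall>w\<in>lists A. \<forall>t. work_pos (tm_run M w t) < s (length w))"

definition DSPACE :: "(nat \<Rightarrow> real) \<Rightarrow> 'a set \<Rightarrow> 'a list set set" where
  "DSPACE f A =
    {L. \<exists>M s. wf_tm A M \<and> decides A M L \<and> space_bounded A M s \<and> (\<lambda>n. real (s n)) \<in> O(f)}"

definition LOGSPACE :: "'a set \<Rightarrow> 'a list set set" where
  "LOGSPACE = DSPACE (\<lambda>n. ln (real n))"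

definition standard_gens :: "('a, 'b) monoid_scheme \<Rightarrow> 'a set \<Rightarrow> 'a set" where
  "standard_gens G S = S \<union> (\<lambda>s. inv\<^bsub>G\<^esub> s) ` S \<union> {\<one>\<^bsub>G\<^esub>}"

definition word_value :: "('a, 'b) monoid_scheme \<Rightarrow> 'a list \<Rightarrow> 'a" where
  "word_value G w = foldr (monoid.mult G) w \<one>\<^bsub>G\<^esub>"

definition word_problem :: "('a, 'b) monoid_scheme \<Rightarrow> 'a set \<Rightarrow> 'a list set" where
  "word_problem G S = {w \<in> lists (standard_gens G S). word_value G w = \<one>\<^bsub>G\<^esub>}"

end

theory Submission
  imports Defs "HOL-Library.Discrete_Functions"
begin

text \<open>Let \<open>Q\<close> be a finite state-closed set of elements that contains the generators and into which
  all iterated states of products of two of its elements eventually fall. Descending a bounded number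
  of levels halves the length of a word over \<open>Q\<close>, so a word of length \<open>n\<close> is trivial as soon as it
  fixes all vertices of some level in \<open>O(log n)\<close>. Such a vertex fits on the work tape. The machine
  runs through all of them, applies the input letters one after the other to each, every letter
  acting as a finite transducer, and compares the result with the vertex it started from.\<close>

section \<open>Sweeping machines\<close>

text \<open>Halving rests on pairing: the state at \<open>v\<close> of a product of two elements of
  \<open>Q\<close> is a single element of \<open>Q\<close> once \<open>v\<close> has length at least
  \<open>d\<close>, and the remaining letters are followed at the image of \<open>v\<close>, which
  is just as deep. The other obstacle is the machine model, with one work tape and no advance
  knowledge of the input length. The space is therefore computed by counting the input, and the
  cells of the counter become the storage. A counter for n has about log n cells; the constant
  factor in the required depth is moved into the alphabet, where one symbol holds a block of up to
  \<open>3 * d\<close> tree letters. Counting, acting by a letter, comparing and passing to the next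
  vertex are all left-to-right passes of a finite automaton over the cells, which a one-tape machine
  can carry out in place.\<close>

fun mealy_run :: "('u \<Rightarrow> 'c \<Rightarrow> 'u \<times> 'd) \<Rightarrow> 'u \<Rightarrow> 'c list \<Rightarrow> 'u \<times> 'd list" where
  "mealy_run f u [] = (u, [])"
| "mealy_run f u (c # cs) =
    (let (u', c') = f u c; (u'', cs') = mealy_run f u' cs in (u'', c' # cs'))"

lemma length_mealy_run [simp]: "length (snd (mealy_run f u cs)) = length cs"
  by (induction cs arbitrary: u) (auto simp: split_beta Let_def)

lemma mealy_run_closed:
  assumes "\<And>u c. u \<in> U \<Longrightarrow> c \<in> C \<Longrightarrow> f u c \<in> U \<times> D" "u \<in> U" "cs \<in> lists C"
  shows "mealy_run f u cs \<in> U \<times> lists D"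
  using assms(3,2)
proof (induction cs arbitrary: u)
  case (Cons c cs)
  from assms(1)[OF Cons.prems Cons.hyps(1)] Cons.IH[of "fst (f u c)"] show ?case
    by (auto simp: split_beta Let_def mem_Times_iff)
qed auto

text \<open>The bound is imposed on every configuration entered along the way, so that termination
  and the space bound come out of one and the same chain.\<close>

definition tm_reach :: "'a tm \<Rightarrow> 'a list \<Rightarrow> nat \<Rightarrow> config \<Rightarrow> config \<Rightarrow> bool" where
  "tm_reach M w B = (\<lambda>c c'. tm_step M w c = c' \<and> work_pos c' \<le> B)\<^sup>*\<^sup>*"

lemma tm_reach_step: "tm_step M w c = c' \<Longrightarrow> work_pos c' \<le> B \<Longrightarrow> tm_reach M w B c c'"
  unfolding tm_reach_def by (rule r_into_rtranclp) simp

lemma tm_reach_refl [simp]: "tm_reach M w B c c"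
  by (simp add: tm_reach_def)

lemma tm_reach_trans [trans]:
  "tm_reach M w B c c' \<Longrightarrow> tm_reach M w B c' c'' \<Longrightarrow> tm_reach M w B c c''"
  unfolding tm_reach_def by (rule rtranclp_trans)

text \<open>The machine is deterministic and a halted configuration is a fixed point of
  \<open>tm_step\<close>, so a finite chain determines the run at all times.\<close>

lemma tm_reach_halted:
  assumes "tm_reach M w B (init_config M) c" "halted M c"
  obtains t where "\<And>t'. t \<le> t' \<Longrightarrow> tm_run M w t' = c" "\<And>t'. work_pos (tm_run M w t') \<le> B"
proof -
  have "\<exists>t. tm_run M w t = c \<and> (\<forall>t'\<le>t. work_pos (tm_run M w t') \<le> B)"
    using assms(1) unfolding tm_reach_def
  proof (induction rule: rtranclp_induct)
    case base
    then show ?case by (intro exI[of _ 0]) (simp add: tm_run_def init_config_def)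
  next
    case (step y z)
    then obtain t where t: "tm_run M w t = y" "\<forall>t'\<le>t. work_pos (tm_run M w t') \<le> B" by blast
    have z: "tm_run M w (Suc t) = z" using step.hyps(2) t(1) by (simp add: tm_run_def)
    with t(2) step.hyps(2) show ?case
      by (intro exI[of _ "Suc t"]) (auto simp: le_Suc_eq)
  qed
  then obtain t where t: "tm_run M w t = c" "\<forall>t'\<le>t. work_pos (tm_run M w t') \<le> B" by blast
  have stay: "tm_run M w t' = c" if "t \<le> t'" for t'
    using that
  proof (induction t' rule: dec_induct)
    case (step n)
    then show ?case using assms(2) by (simp add: tm_run_def tm_step_def)
  qed (use t in simp)
  show thesis
    by (rule that[of t]) (use stay t in \<open>metis nat_le_linear order_refl\<close>)+
qed

datatype ('r, 'u) sweep_ctrl = At 'r | Sweep 'u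

text \<open>A work head told to move left at position 0 stays there without noticing.
  \<open>Mark\<close>, kept at position 0, makes the left end recognisable; the first
  \<open>Blank\<close> is the right end of the list.\<close>

datatype 'c sweep_sym = Blank | Mark | Cell 'c

text \<open>A configuration of a sweeping machine consists of a control state, the position of the input
  head and the list of work cells. In one step the machine reads one input symbol, moves the input
  head, transforms the whole list by a Mealy automaton, and possibly appends one cell.\<close>

locale sweeping_machine =
  fixes A :: "'a set" and R :: "'r set" and U :: "'u set" and C :: "'c set"
    and r0 acc rej :: 'r
    and start :: "'r \<Rightarrow> 'a input_symbol \<Rightarrow> 'u \<times> move"
    and mealy :: "'u \<Rightarrow> 'c \<Rightarrow> 'u \<times> 'c"
    and fin :: "'u \<Rightarrow> 'r \<times> 'c option"
  assumes finite_sets: "finite A" "finite R" "finite U" "finite C"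
    and states_in: "r0 \<in> R" "acc \<in> R" "rej \<in> R"
    and states_distinct: "acc \<noteq> rej" "r0 \<noteq> acc" "r0 \<noteq> rej"
    and start_in: "r \<in> R \<Longrightarrow> a \<in> {Left_End, Right_End} \<union> Letter ` A \<Longrightarrow> fst (start r a) \<in> U"
    and mealy_in: "u \<in> U \<Longrightarrow> c \<in> C \<Longrightarrow> mealy u c \<in> U \<times> C"
    and fin_in: "u \<in> U \<Longrightarrow> fst (fin u) \<in> R" "u \<in> U \<Longrightarrow> set_option (snd (fin u)) \<subseteq> C"
begin

definition sweep_step :: "'a list \<Rightarrow> 'r \<times> nat \<times> 'c list \<Rightarrow> 'r \<times> nat \<times> 'c list" where
  "sweep_step w = (\<lambda>(r, i, cs).
     let (u, d) = start r (read_input w i);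
         (u', cs') = mealy_run mealy u cs;
         (r', x) = fin u'
     in (r', min (length w + 1) (move_head d i), cs' @ (case x of None \<Rightarrow> [] | Some c \<Rightarrow> [c])))"

definition sweep_reach ::
    "'a list \<Rightarrow> nat \<Rightarrow> 'r \<times> nat \<times> 'c list \<Rightarrow> 'r \<times> nat \<times> 'c list \<Rightarrow> bool" where
  "sweep_reach w B = (\<lambda>c c'. fst c \<notin> {acc, rej} \<and> sweep_step w c = c' \<and>
     length (snd (snd c')) \<le> B)\<^sup>*\<^sup>*"

lemma sweep_reach_step:
  "sweep_step w c = c' \<Longrightarrow> fst c \<notin> {acc, rej} \<Longrightarrow> length (snd (snd c')) \<le> B \<Longrightarrow> sweep_reach w B c c'"
  unfolding sweep_reach_def by (rule r_into_rtranclp) simp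

lemma sweep_reach_refl [simp]: "sweep_reach w B c c"
  by (simp add: sweep_reach_def)

lemma sweep_reach_trans [trans]:
  "sweep_reach w B c c' \<Longrightarrow> sweep_reach w B c' c'' \<Longrightarrow> sweep_reach w B c c''"
  unfolding sweep_reach_def by (rule rtranclp_trans)

text \<open>In \<open>At r\<close> the head walks left to the marker; only there is the input symbol
  used and the input head moved. In \<open>Sweep u\<close> it walks right, rewriting cells, until
  the first blank, where a cell may be appended. The clause for \<open>At r\<close> on
  \<open>Blank\<close> writes the marker in the very first step.\<close>

fun sweep_delta :: "('r, 'u) sweep_ctrl \<Rightarrow> 'a input_symbol \<Rightarrow> 'c sweep_sym \<Rightarrow>
    ('r, 'u) sweep_ctrl \<times> 'c sweep_sym \<times> move \<times> move" where
  "sweep_delta (At r) a Blank = (At r, Mark, Stay, Stay)"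
| "sweep_delta (At r) a Mark = (Sweep (fst (start r a)), Mark, snd (start r a), Move_Right)"
| "sweep_delta (At r) a (Cell c) = (At r, Cell c, Stay, Move_Left)"
| "sweep_delta (Sweep u) a Mark = (Sweep u, Mark, Stay, Stay)"
| "sweep_delta (Sweep u) a (Cell c) =
    (Sweep (fst (mealy u c)), Cell (snd (mealy u c)), Stay, Move_Right)"
| "sweep_delta (Sweep u) a Blank =
    (At (fst (fin u)), (case snd (fin u) of None \<Rightarrow> Blank | Some c \<Rightarrow> Cell c), Stay, Move_Left)"

definition ctrls :: "('r, 'u) sweep_ctrl set" where "ctrls = At ` R \<union> Sweep ` U"

definition syms :: "'c sweep_sym set" where "syms = {Blank, Mark} \<union> Cell ` C"

text \<open>The machine model has natural numbers as control states and work symbols; any injection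
  of the finite set serves as a numbering, and \<open>inv_into\<close> decodes it in
  \<open>machine\<close>.\<close>

definition ctrl_code :: "('r, 'u) sweep_ctrl \<Rightarrow> nat" where
  "ctrl_code = (SOME f. inj_on f ctrls)"

definition sym_code :: "'c sweep_sym \<Rightarrow> nat" where
  "sym_code = (SOME f. inj_on f syms)"

definition machine :: "'a tm" where
  "machine = \<lparr>control = ctrl_code ` ctrls, work_alphabet = sym_code ` syms,
    blank = sym_code Blank, start = ctrl_code (At r0),
    accept = ctrl_code (At acc), reject = ctrl_code (At rej),
    delta = (\<lambda>q a c. map_prod ctrl_code (map_prod sym_code id)
      (sweep_delta (inv_into ctrls ctrl_code q) a (inv_into syms sym_code c)))\<rparr>"

lemma inj_ctrl_code: "inj_on ctrl_code ctrls"
proof -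
  have "finite ctrls" by (simp add: ctrls_def finite_sets)
  then show ?thesis
    unfolding ctrl_code_def by (metis (mono_tags) finite_imp_inj_to_nat_seg someI_ex)
qed

lemma inj_sym_code: "inj_on sym_code syms"
proof -
  have "finite syms" by (simp add: syms_def finite_sets)
  then show ?thesis
    unfolding sym_code_def by (metis (mono_tags) finite_imp_inj_to_nat_seg someI_ex)
qed

lemma At_in [simp]: "At r \<in> ctrls \<longleftrightarrow> r \<in> R"
  and Sweep_in [simp]: "Sweep u \<in> ctrls \<longleftrightarrow> u \<in> U"
  and syms_in [simp]: "Blank \<in> syms" "Mark \<in> syms" "Cell c \<in> syms \<longleftrightarrow> c \<in> C"
  by (auto simp: ctrls_def syms_def)

lemma ctrl_code_eq_iff: "q \<in> ctrls \<Longrightarrow> q' \<in> ctrls \<Longrightarrow> ctrl_code q = ctrl_code q' \<longleftrightarrow> q = q'"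
  using inj_ctrl_code by (auto dest: inj_onD)

lemma delta_machine:
  "q \<in> ctrls \<Longrightarrow> c \<in> syms \<Longrightarrow> delta machine (ctrl_code q) a (sym_code c) =
    map_prod ctrl_code (map_prod sym_code id) (sweep_delta q a c)"
  by (simp add: machine_def inv_into_f_f inj_ctrl_code inj_sym_code)

lemma sweep_delta_in:
  assumes "q \<in> ctrls" "a \<in> {Left_End, Right_End} \<union> Letter ` A" "c \<in> syms"
  shows "sweep_delta q a c \<in> ctrls \<times> syms \<times> UNIV"
  using assms start_in[of _ a] fin_in mealy_in
  by (cases "(q, a, c)" rule: sweep_delta.cases) (auto simp: mem_Times_iff split: option.splits)

lemma wf_machine: "wf_tm A machine"
  unfolding wf_tm_def
proof (intro conjI ballI allI impI)
  fix q a c q' c' d e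
  assume "q \<in> control machine" and a: "a \<in> {Left_End, Right_End} \<union> Letter ` A"
    and "c \<in> work_alphabet machine" and eq: "delta machine q a c = (q', c', d, e)"
  then obtain p b where "p \<in> ctrls" "b \<in> syms" "q = ctrl_code p" "c = sym_code b"
    by (auto simp: machine_def)
  with eq sweep_delta_in[OF _ a, of p b]
  show "q' \<in> control machine" "c' \<in> work_alphabet machine"
    by (auto simp: delta_machine) (auto simp: machine_def)
qed (use states_in states_distinct in
  \<open>auto simp: machine_def finite_sets ctrls_def syms_def ctrl_code_eq_iff\<close>)

section \<open>Simulation of sweeps on the work tape\<close>

definition tape :: "'c list \<Rightarrow> nat \<Rightarrow> nat" where
  "tape cs j = sym_code (if j = 0 then Mark else if j \<le> length cs then Cell (cs ! (j - 1)) else Blank)"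

definition cfg :: "('r, 'u) sweep_ctrl \<Rightarrow> nat \<Rightarrow> nat \<Rightarrow> 'c list \<Rightarrow> config" where
  "cfg q i p cs = \<lparr>ctrl = ctrl_code q, in_pos = i, work_pos = p, work = tape cs\<rparr>"

lemma halted_At: "r \<in> R \<Longrightarrow> halted machine \<lparr>ctrl = ctrl_code (At r), in_pos = i, work_pos = p, work = f\<rparr> \<longleftrightarrow> r \<in> {acc, rej}"
  and halted_Sweep: "u \<in> U \<Longrightarrow> \<not> halted machine \<lparr>ctrl = ctrl_code (Sweep u), in_pos = i, work_pos = p, work = f\<rparr>"
  using states_in by (auto simp: halted_def machine_def ctrl_code_eq_iff)

lemma step_At_Cell:
  assumes "r \<in> R" "r \<notin> {acc, rej}" "cs \<in> lists C" "i \<le> length w + 1" "Suc p \<le> length cs"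
  shows "tm_step machine w (cfg (At r) i (Suc p) cs) = cfg (At r) i p cs"
proof -
  have "cs ! p \<in> C" using assms(3,5) by (auto simp: in_lists_conv_set)
  moreover have "(tape cs)(Suc p := sym_code (Cell (cs ! p))) = tape cs"
    using assms(5) by (auto simp: tape_def)
  ultimately show ?thesis
    using assms halted_At[OF assms(1)]
    by (simp add: tm_step_def cfg_def delta_machine tape_def min_absorb2)
qed

lemma reach_Mark:
  assumes "r \<in> R" "r \<notin> {acc, rej}" "cs \<in> lists C" "i \<le> length w + 1" "p \<le> length cs"
    "length cs \<le> B"
  shows "tm_reach machine w B (cfg (At r) i p cs) (cfg (At r) i 0 cs)"
  using assms(5)
proof (induction p)
  case (Suc p)
  have "tm_reach machine w B (cfg (At r) i (Suc p) cs) (cfg (At r) i p cs)"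
    by (rule tm_reach_step[OF step_At_Cell]) (use assms Suc.prems in \<open>auto simp: cfg_def\<close>)
  also have "tm_reach machine w B \<dots> (cfg (At r) i 0 cs)" using Suc by simp
  finally show ?case .
qed simp

lemma step_At_Mark:
  assumes "r \<in> R" "r \<notin> {acc, rej}"
  shows "tm_step machine w (cfg (At r) i 0 cs) =
    cfg (Sweep (fst (start r (read_input w i))))
      (min (length w + 1) (move_head (snd (start r (read_input w i))) i)) 1 cs"
proof -
  have "(tape cs)(0 := sym_code Mark) = tape cs" by (auto simp: tape_def)
  then show ?thesis
    using assms halted_At[OF assms(1)]
    by (simp add: tm_step_def cfg_def delta_machine tape_def)
qed

lemma step_Sweep_Cell:
  assumes "u \<in> U" "i \<le> length w + 1" "c \<in> C"
  shows "tm_step machine w (cfg (Sweep u) i (Suc (length ds)) (ds @ c # cs)) =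
    cfg (Sweep (fst (mealy u c))) i (Suc (Suc (length ds))) (ds @ snd (mealy u c) # cs)"
proof -
  have "(tape (ds @ c # cs))(Suc (length ds) := sym_code (Cell c')) = tape (ds @ c' # cs)" for c'
    by (rule ext) (auto simp: tape_def nth_append nth_Cons split: nat.splits)
  then show ?thesis
    using assms halted_Sweep[OF assms(1)]
    by (simp add: tm_step_def cfg_def delta_machine tape_def min_absorb2)
qed

text \<open>The induction needs the part \<open>ds\<close> already rewritten as a parameter. The
  head stops on the first blank, one position beyond the last cell, whence
  \<open>Suc B\<close>.\<close>

lemma reach_Sweep:
  assumes "u \<in> U" "i \<le> length w + 1" "cs \<in> lists C" "length ds + length cs \<le> B"
  shows "tm_reach machine w (Suc B) (cfg (Sweep u) i (Suc (length ds)) (ds @ cs))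
    (cfg (Sweep (fst (mealy_run mealy u cs))) i (Suc (length ds + length cs))
      (ds @ snd (mealy_run mealy u cs)))"
  using assms(1,3,4)
proof (induction cs arbitrary: u ds)
  case (Cons c cs)
  then have c: "c \<in> C" "cs \<in> lists C" by auto
  note m = mealy_in[OF Cons.prems(1) c(1)]
  have "tm_reach machine w (Suc B) (cfg (Sweep u) i (Suc (length ds)) (ds @ c # cs))
    (cfg (Sweep (fst (mealy u c))) i (Suc (Suc (length ds))) (ds @ snd (mealy u c) # cs))"
    by (rule tm_reach_step[OF step_Sweep_Cell[OF Cons.prems(1) assms(2) c(1)]])
      (use Cons.prems in \<open>simp add: cfg_def\<close>)
  also have "tm_reach machine w (Suc B) \<dots>
    (cfg (Sweep (fst (mealy_run mealy u (c # cs)))) i (Suc (length ds + length (c # cs)))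
      (ds @ snd (mealy_run mealy u (c # cs))))"
    using Cons.IH[of "fst (mealy u c)" "ds @ [snd (mealy u c)]"] m c Cons.prems(3)
    by (auto simp: split_beta Let_def mem_Times_iff)
  finally show ?case .
qed simp

lemma step_Sweep_Blank:
  assumes "u \<in> U" "i \<le> length w + 1"
  shows "tm_step machine w (cfg (Sweep u) i (Suc (length cs)) cs) =
    cfg (At (fst (fin u))) i (length cs)
      (cs @ (case snd (fin u) of None \<Rightarrow> [] | Some c \<Rightarrow> [c]))"
proof -
  have "(tape cs)(Suc (length cs) := sym_code Blank) = tape cs"
    by (rule ext) (auto simp: tape_def)
  moreover have "(tape cs)(Suc (length cs) := sym_code (Cell c)) = tape (cs @ [c])" for c
    by (rule ext) (auto simp: tape_def nth_append)
  ultimately show ?thesis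
    using assms halted_Sweep[OF assms(1)]
    by (simp add: tm_step_def cfg_def delta_machine tape_def min_absorb2 split: option.splits)
qed

lemma read_input_in: "w \<in> lists A \<Longrightarrow> read_input w i \<in> {Left_End, Right_End} \<union> Letter ` A"
  by (auto simp: read_input_def in_lists_conv_set)

text \<open>The final left move starts from the position where a cell may have been appended, so the
  head ends at \<open>length cs\<close>, which may or may not be the last cell of
  \<open>cs'\<close>. For this reason the starting position \<open>p\<close> is arbitrary up to the
  end of the list.\<close>

lemma sweep_step_simulated:
  assumes w: "w \<in> lists A" and r: "r \<in> R" "r \<notin> {acc, rej}" and cs: "cs \<in> lists C"
    and i: "i \<le> length w + 1" and p: "p \<le> length cs"
    and st: "sweep_step w (r, i, cs) = (r', i', cs')" and B: "length cs' \<le> B"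
  shows "r' \<in> R \<and> cs' \<in> lists C \<and> i' \<le> length w + 1 \<and> length cs \<le> length cs' \<and>
    tm_reach machine w (Suc B) (cfg (At r) i p cs) (cfg (At r') i' (length cs) cs')"
proof -
  define u where "u = fst (start r (read_input w i))"
  define v where "v = fst (mealy_run mealy u cs)"
  define ds where "ds = snd (mealy_run mealy u cs)"
  have u: "u \<in> U" unfolding u_def by (rule start_in[OF r(1) read_input_in[OF w]])
  have v: "v \<in> U" "ds \<in> lists C"
    using mealy_run_closed[OF mealy_in u cs] by (auto simp: v_def ds_def mem_Times_iff)
  have len: "length ds = length cs" by (simp add: ds_def)
  have eqs: "r' = fst (fin v)" "i' = min (length w + 1) (move_head (snd (start r (read_input w i))) i)"
    "cs' = ds @ (case snd (fin v) of None \<Rightarrow> [] | Some c \<Rightarrow> [c])"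
    using st by (auto simp: sweep_step_def u_def v_def ds_def split_beta Let_def)
  have i': "i' \<le> length w + 1" by (simp add: eqs)
  have B': "length cs \<le> B" using B len eqs(3) by simp
  have "tm_reach machine w (Suc B) (cfg (At r) i p cs) (cfg (At r) i 0 cs)"
    using reach_Mark[OF r cs i p, of "Suc B"] B' by simp
  also have "tm_reach machine w (Suc B) \<dots> (cfg (Sweep u) i' 1 cs)"
    by (rule tm_reach_step[OF step_At_Mark[OF r, of w i cs, folded u_def eqs(2)]])
      (simp add: cfg_def)
  also have "tm_reach machine w (Suc B) \<dots> (cfg (Sweep v) i' (Suc (length ds)) ds)"
    using reach_Sweep[OF u i' cs, of "[]" B] B' by (simp add: v_def ds_def)
  also have "tm_reach machine w (Suc B) \<dots> (cfg (At r') i' (length ds) cs')"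
    by (rule tm_reach_step[OF step_Sweep_Blank[OF v(1) i', of ds, folded eqs]])
      (use B' len in \<open>simp add: cfg_def\<close>)
  finally show ?thesis
    using v i' len eqs fin_in[OF v(1)] by (auto split: option.splits)
qed

lemma sweep_reach_simulated:
  assumes w: "w \<in> lists A" and "sweep_reach w B (r0, 0, []) (r, i, cs)"
  shows "r \<in> R \<and> cs \<in> lists C \<and> i \<le> length w + 1 \<and>
    (\<exists>p\<le>length cs. tm_reach machine w (Suc B) (init_config machine) (cfg (At r) i p cs))"
  using assms(2) unfolding sweep_reach_def
proof (induction "(r, i, cs)" arbitrary: r i cs rule: rtranclp_induct)
  case base
  \<comment> \<open>The empty tape does not yet have the shape \<open>tape []\<close>; one step
    writes the marker. That step takes place because \<open>r0\<close> is not a halting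
    state.\<close>
  have "(\<lambda>_. sym_code Blank)(0 := sym_code Mark) = tape []"
    by (rule ext) (simp add: tape_def)
  then have "tm_step machine w (init_config machine) = cfg (At r0) 0 0 []"
    using states_in states_distinct halted_At[OF states_in(1)]
    by (simp add: tm_step_def init_config_def cfg_def machine_def[THEN arg_cong, of tm.start]
      machine_def[THEN arg_cong, of blank] delta_machine)
  then have "tm_reach machine w (Suc B) (init_config machine) (cfg (At r0) 0 0 [])"
    by (rule tm_reach_step) (simp add: cfg_def)
  then show ?case using states_in by auto
next
  case (step y)
  obtain r1 i1 cs1 where y: "y = (r1, i1, cs1)" by (cases y)
  from step.hyps(3)[OF y] obtain p where *: "r1 \<in> R" "cs1 \<in> lists C" "i1 \<le> length w + 1"
    "p \<le> length cs1" "tm_reach machine w (Suc B) (init_config machine) (cfg (At r1) i1 p cs1)"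
    by blast
  from step.hyps(2) y have "r1 \<notin> {acc, rej}" "sweep_step w (r1, i1, cs1) = (r, i, cs)"
    "length cs \<le> B" by auto
  from sweep_step_simulated[OF w *(1) this(1) *(2,3,4) this(2,3)] *(5) show ?case
    by (blast intro: tm_reach_trans)
qed

text \<open>Besides the cells, the head visits the marker at 0 and the first blank after the list,
  so its position stays below \<open>s n + 2\<close>.\<close>

theorem sweeping_DSPACE:
  assumes L: "L \<subseteq> lists A"
    and run: "\<And>w. w \<in> lists A \<Longrightarrow>
      \<exists>i cs. sweep_reach w (s (length w)) (r0, 0, []) (if w \<in> L then acc else rej, i, cs)"
    and s: "(\<lambda>n. real (s n + 2)) \<in> O(f)"
  shows "L \<in> DSPACE f A"
proof -
  have key: "\<exists>c t. (\<forall>t'\<ge>t. tm_run machine w t' = c) \<and> halted machine c \<and>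
      (\<forall>t'. work_pos (tm_run machine w t') < s (length w) + 2) \<and>
      ctrl c = (if w \<in> L then accept machine else reject machine)" if w: "w \<in> lists A" for w
  proof -
    obtain i cs where "sweep_reach w (s (length w)) (r0, 0, []) (if w \<in> L then acc else rej, i, cs)"
      using run[OF w] by blast
    from sweep_reach_simulated[OF w this] obtain p where
      "tm_reach machine w (Suc (s (length w))) (init_config machine)
        (cfg (At (if w \<in> L then acc else rej)) i p cs)" (is "tm_reach _ _ _ _ ?c") by blast
    moreover have h: "halted machine ?c" using halted_At states_in by (simp add: cfg_def)
    ultimately obtain t where "\<And>t'. t \<le> t' \<Longrightarrow> tm_run machine w t' = ?c"
      "\<And>t'. work_pos (tm_run machine w t') \<le> Suc (s (length w))"
      by (rule tm_reach_halted) blast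
    with h show ?thesis
      by (intro exI[of _ ?c] exI[of _ t]) (auto simp: less_Suc_eq_le cfg_def machine_def)
  qed
  have ne: "accept machine \<noteq> reject machine" using wf_machine by (simp add: wf_tm_def)
  have "decides A machine L"
    unfolding decides_def
  proof (intro conjI ballI L)
    fix w assume "w \<in> lists A"
    from key[OF this] obtain c t where ct: "\<And>t'. t \<le> t' \<Longrightarrow> tm_run machine w t' = c"
      "halted machine c" "ctrl c = (if w \<in> L then accept machine else reject machine)" by blast
    then show "\<exists>t. halted machine (tm_run machine w t)" by force
    show "(\<exists>t. ctrl (tm_run machine w t) = accept machine) \<longleftrightarrow> w \<in> L"
    proof
      assume "\<exists>t. ctrl (tm_run machine w t) = accept machine"
      then obtain t1 where t1: "ctrl (tm_run machine w t1) = accept machine" by blast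
      \<comment> \<open>An accepting configuration persists, so it has to agree with the final
        configuration \<open>c\<close>.\<close>
      have "tm_run machine w (t1 + n) = tm_run machine w t1" for n
        using t1 by (induction n) (auto simp: tm_run_def tm_step_def halted_def)
      then have "ctrl c = accept machine" using ct(1)[of "t1 + t"] t1 by simp
      then show "w \<in> L" using ct(3) ne by (auto split: if_splits)
    next
      assume "w \<in> L"
      then show "\<exists>t. ctrl (tm_run machine w t) = accept machine" using ct(1)[of t] ct(3) by auto
    qed
  qed
  moreover have "space_bounded A machine (\<lambda>n. s n + 2)"
    unfolding space_bounded_def using key by blast
  ultimately show ?thesis
    unfolding DSPACE_def using wf_machine s by blast
qed

end

section \<open>Words fixed by transducers\<close>

lemma horner_sum_less:
  fixes b :: nat
  shows "set as \<subseteq> {..<b} \<Longrightarrow> horner_sum (\<lambda>a. a) b as < b ^ length as"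
proof (induction as)
  case (Cons a as)
  then have "Suc (horner_sum (\<lambda>a. a) b as) * b \<le> b ^ length as * b"
    by (intro mult_right_mono) auto
  with Cons.prems show ?case by (simp add: algebra_simps)
qed simp

lemma horner_sum_inj:
  fixes b :: nat
  assumes "set as \<subseteq> {..<b}" "set as' \<subseteq> {..<b}" "length as = length as'"
    "horner_sum (\<lambda>a. a) b as = horner_sum (\<lambda>a. a) b as'"
  shows "as = as'"
  using assms(3,1,2,4)
proof (induction as as' rule: list_induct2)
  case (Cons a as a' as')
  then have eq: "a + b * horner_sum (\<lambda>a. a) b as = a' + b * horner_sum (\<lambda>a. a) b as'" by simp
  have "a = a'" using arg_cong[OF eq, of "\<lambda>x. x mod b"] Cons.prems by (simp del: add_left_cancel)
  with eq Cons show ?case by auto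
qed simp

lemma floor_log_bigo_ln: "(\<lambda>n. real (floor_log (n + 1) + 2)) \<in> O(\<lambda>n. ln (real n))"
proof -
  have "(\<lambda>n. real (floor_log (n + 1) + 2)) \<in> O(\<lambda>n. log 2 (real n + 1) + 2)"
  proof (rule bigoI[of _ 1], rule always_eventually, rule allI)
    fix n :: nat
    have "real (2 ^ floor_log (n + 1)) \<le> real (n + 1)"
      unfolding of_nat_le_iff by (rule floor_log_exp2_le) simp
    then have "real (floor_log (n + 1)) \<le> log 2 (real (n + 1))"
      by (intro le_log_of_power) simp_all
    then show "norm (real (floor_log (n + 1) + 2)) \<le> 1 * norm (log 2 (real n + 1) + 2)"
      by (simp add: add.commute)
  qed
  also have "(\<lambda>n. log 2 (real n + 1) + 2) \<in> O(\<lambda>n. ln (real n))"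
  \<comment> \<open>From 3 on, n + 1 is at most n ^ 2, which gives the summand
    \<open>2 / ln 2\<close>, and the logarithm is at least 1, so it absorbs the additive 2.\<close>
  proof (rule bigoI[of _ "2 / ln 2 + 2"], rule eventually_at_top_linorderI[of 3])
    fix n :: nat
    assume n: "3 \<le> n"
    have "1 \<le> ln (real n)"
      using n exp_le by (subst ln_ge_iff) auto
    have "n + 1 \<le> n ^ 2"
      using n mult_le_mono1[of 3 n n] unfolding power2_eq_square by linarith
    then have "real n + 1 \<le> real n ^ 2"
      by (metis of_nat_1 of_nat_add of_nat_le_iff of_nat_power)
    then have "ln (real n + 1) \<le> ln (real n ^ 2)" using n by (subst ln_le_cancel_iff) auto
    also have "\<dots> = 2 * ln (real n)" using n by (simp add: ln_realpow)
    finally have "log 2 (real n + 1) \<le> 2 * ln (real n) / ln 2"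
      by (simp add: log_def divide_right_mono)
    with \<open>1 \<le> ln (real n)\<close> show "norm (log 2 (real n + 1) + 2) \<le> (2 / ln 2 + 2) * norm (ln (real n))"
      by (simp add: algebra_simps)
  qed
  finally show ?thesis .
qed

datatype phase = Count | Rewind | Read | Accept | Reject

instance phase :: finite
proof
  have "(UNIV :: phase set) = {Count, Rewind, Read, Accept, Reject}" using phase.exhaust by auto
  then show "finite (UNIV :: phase set)" by (metis finite.emptyI finite.insertI)
qed

text \<open>The flag of \<open>Increment\<close> is the carry. \<open>Apply\<close> holds the
  current state of the transducer. The flags of \<open>Check\<close> are the outcome of the
  comparison so far and the carry.\<close>

datatype 'm pass = Increment bool | Reset | Apply 'm | Check bool bool | Keep phase

text \<open>The work cells are pairs of a digit and a letter of the transducer alphabet, which is listed,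
  possibly with repetitions, by \<open>ys\<close>. The number of cells is fixed by counting the input letters in
  bijective binary notation. Then the digits run through all numbers in base \<open>length ys\<close>, and the
  letters are the image of the word coded by the digits under the input read so far.\<close>

locale transducer =
  fixes A Q :: "'m set" and step :: "'m \<Rightarrow> 'y \<Rightarrow> 'm \<times> 'y" and ys :: "'y list"
  assumes finite_Q: "finite Q" and A_subset: "A \<subseteq> Q"
    and step_in: "m \<in> Q \<Longrightarrow> y \<in> set ys \<Longrightarrow> step m y \<in> Q \<times> set ys"
    and two_le: "2 \<le> length ys"
begin

fun pass_start :: "phase \<Rightarrow> 'm input_symbol \<Rightarrow> 'm pass \<times> move" where
  "pass_start Count Left_End = (Increment False, Move_Right)"
| "pass_start Count (Letter m) = (Increment True, Move_Right)"
| "pass_start Count Right_End = (Reset, Stay)"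
| "pass_start Rewind Left_End = (Keep Read, Move_Right)"
| "pass_start Rewind _ = (Keep Rewind, Move_Left)"
| "pass_start Read (Letter m) = (Apply m, Move_Right)"
| "pass_start Read Right_End = (Check True True, Stay)"
| "pass_start p _ = (Keep p, Stay)"

text \<open>While counting, the bijective binary digits 1 and 2 are stored as 0 and 1, least
  significant first. \<open>Check\<close> does three things to a cell at once: it compares the
  letter with the one its digit codes, increments the digit if there is a carry, and reloads the
  letter for the next round.\<close>

fun pass_cell :: "'m pass \<Rightarrow> nat \<times> 'y \<Rightarrow> 'm pass \<times> nat \<times> 'y" where
  "pass_cell (Increment c) (a, y) =
    (if \<not> c then (Increment False, a, y)
     else if a = 0 then (Increment False, 1, y) else (Increment True, 0, y))"
| "pass_cell Reset (a, y) = (Reset, 0, ys ! 0)"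
| "pass_cell (Apply m) (a, y) = (Apply (fst (step m y)), a, snd (step m y))"
| "pass_cell (Check ok c) (a, y) =
    (let a' = if c then if Suc a < length ys then Suc a else 0 else a
     in (Check (ok \<and> ys ! a = y) (c \<and> \<not> Suc a < length ys), a', ys ! a'))"
| "pass_cell (Keep p) x = (Keep p, x)"

text \<open>A carry left over from \<open>Increment\<close> adds a new leading digit 1, stored as 0.
  A carry left over from \<open>Check\<close> means that the largest code has just been tested, so
  all codes have passed.\<close>

fun pass_end :: "'m pass \<Rightarrow> phase \<times> (nat \<times> 'y) option" where
  "pass_end (Increment c) = (Count, if c then Some (0, ys ! 0) else None)"
| "pass_end Reset = (Rewind, None)"
| "pass_end (Apply m) = (Read, None)"
| "pass_end (Check ok c) = (if \<not> ok then Reject else if c then Accept else Rewind, None)"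
| "pass_end (Keep p) = (p, None)"

definition passes :: "'m pass set" where
  "passes = range Increment \<union> {Reset} \<union> Apply ` Q \<union> range (case_prod Check) \<union> range Keep"

lemma passes_in [simp]: "Increment c \<in> passes" "Reset \<in> passes" "Apply m \<in> passes \<longleftrightarrow> m \<in> Q"
  "Check ok c \<in> passes" "Keep p \<in> passes"
  by (auto simp: passes_def)

sublocale sweeping_machine A UNIV passes "{..<length ys} \<times> set ys" Count Accept Reject
  pass_start pass_cell pass_end
proof
  show "finite A" using finite_Q A_subset finite_subset by blast
  show "finite passes" by (simp add: passes_def finite_Q)
  show "fst (pass_start r a) \<in> passes" if "a \<in> {Left_End, Right_End} \<union> Letter ` A" for r a
    using that A_subset by (cases "(r, a)" rule: pass_start.cases) auto
  have zero_in: "ys ! 0 \<in> set ys" using two_le by (intro nth_mem) linarith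
  show "pass_cell u c \<in> passes \<times> {..<length ys} \<times> set ys"
    if "u \<in> passes" "c \<in> {..<length ys} \<times> set ys" for u c
    using that step_in[of _ "snd c"] two_le zero_in
    by (cases "(u, c)" rule: pass_cell.cases) (auto simp: Let_def mem_Times_iff)
  show "set_option (snd (pass_end u)) \<subseteq> {..<length ys} \<times> set ys" if "u \<in> passes" for u
    using zero_in two_le by (cases u) auto
qed auto

definition act :: "'m \<Rightarrow> 'y list \<Rightarrow> 'y list" where
  "act m vs = snd (mealy_run step m vs)"

lemma length_act [simp]: "length (act m vs) = length vs" by (simp add: act_def)

definition cells :: "nat list \<Rightarrow> (nat \<times> 'y) list" where
  "cells as = zip as (map ((!) ys) as)"

lemma length_cells [simp]: "length (cells as) = length as" by (simp add: cells_def)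

section \<open>Effect of a single pass on the cells\<close>

lemma run_Increment_False:
  "mealy_run pass_cell (Increment False) cs = (Increment False, cs)"
  by (induction cs) auto

lemma run_Keep: "mealy_run pass_cell (Keep p) cs = (Keep p, cs)"
  by (induction cs) auto

lemma run_Reset: "mealy_run pass_cell Reset cs = (Reset, cells (replicate (length cs) 0))"
  by (induction cs) (auto simp: cells_def)

lemma run_Apply:
  "length as = length vs \<Longrightarrow>
    mealy_run pass_cell (Apply m) (zip as vs) = (Apply (fst (mealy_run step m vs)), zip as (act m vs))"
  by (induction as vs arbitrary: m rule: list_induct2) (auto simp: split_beta Let_def act_def)

lemma run_Increment_True:
  assumes "fst ` set cs \<subseteq> {0, 1}"
  shows "\<exists>c' cs'. mealy_run pass_cell (Increment True) cs = (Increment c', cs') \<and>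
    fst ` set cs' \<subseteq> {0, 1} \<and>
    horner_sum (\<lambda>c. Suc (fst c)) 2 (cs' @ (if c' then [(0, ys ! 0)] else [])) =
      Suc (horner_sum (\<lambda>c. Suc (fst c)) 2 cs)"
  using assms
proof (induction cs)
  case (Cons c cs)
  obtain a y where c: "c = (a, y)" by (cases c)
  from Cons obtain c' cs' where IH: "mealy_run pass_cell (Increment True) cs = (Increment c', cs')"
    "fst ` set cs' \<subseteq> {0, 1}"
    "horner_sum (\<lambda>c. Suc (fst c)) 2 (cs' @ (if c' then [(0, ys ! 0)] else [])) =
      Suc (horner_sum (\<lambda>c. Suc (fst c)) 2 cs)" by auto
  from Cons.prems c consider "a = 0" | "a = 1" by auto
  then show ?case
  proof cases
    case 1
    with Cons.prems c show ?thesis by (auto simp: run_Increment_False intro!: exI[of _ False])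
  next
    case 2
    with IH c show ?thesis by simp
  qed
qed (auto intro!: exI[of _ True])

text \<open>This is addition with carry: a final carry stands for the power of the base lost when
  the digits wrap around.\<close>

lemma run_Check:
  assumes "length as = length vs" "set as \<subseteq> {..<length ys}"
  shows "\<exists>c' as'. mealy_run pass_cell (Check ok c) (zip as vs) =
      (Check (ok \<and> vs = map ((!) ys) as) c', cells as') \<and>
    length as' = length as \<and> set as' \<subseteq> {..<length ys} \<and>
    horner_sum (\<lambda>a. a) (length ys) as' + (if c' then length ys ^ length as else 0) =
      horner_sum (\<lambda>a. a) (length ys) as + (if c then 1 else 0)"
  using assms
proof (induction as vs arbitrary: ok c rule: list_induct2)
  case (Cons a as v vs)
  let ?a = "if c then if Suc a < length ys then Suc a else 0 else a"
  let ?ok = "ok \<and> ys ! a = v" and ?c = "c \<and> \<not> Suc a < length ys"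
  have "set as \<subseteq> {..<length ys}" using Cons.prems by simp
  from Cons.IH[OF this, of ?ok ?c]
  obtain c' as' where IH: "mealy_run pass_cell (Check ?ok ?c) (zip as vs) =
      (Check (?ok \<and> vs = map ((!) ys) as) c', cells as')"
    "length as' = length as" "set as' \<subseteq> {..<length ys}"
    "horner_sum (\<lambda>a. a) (length ys) as' + (if c' then length ys ^ length as else 0) =
      horner_sum (\<lambda>a. a) (length ys) as + (if ?c then 1 else 0)" by blast
  have b: "Suc a = length ys" if "\<not> Suc a < length ys" using that Cons.prems by simp
  have "mealy_run pass_cell (Check ok c) (zip (a # as) (v # vs)) =
      (Check (ok \<and> v # vs = map ((!) ys) (a # as)) c', cells (?a # as'))"
    using IH(1) by (auto simp: Let_def cells_def)
  moreover have "length (?a # as') = length (a # as)" "set (?a # as') \<subseteq> {..<length ys}"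
    using IH(2,3) Cons.prems two_le by auto
  moreover have "horner_sum (\<lambda>a. a) (length ys) (?a # as') +
      (if c' then length ys ^ length (a # as) else 0) =
      horner_sum (\<lambda>a. a) (length ys) (a # as) + (if c then 1 else 0)"
  proof -
    have "horner_sum (\<lambda>a. a) (length ys) (?a # as') + (if c' then length ys ^ length (a # as) else 0) =
      ?a + length ys * (horner_sum (\<lambda>a. a) (length ys) as' + (if c' then length ys ^ length as else 0))"
      by (simp add: algebra_simps)
    also have "\<dots> = ?a + length ys * (horner_sum (\<lambda>a. a) (length ys) as + (if ?c then 1 else 0))"
      by (simp only: IH(4))
    also have "\<dots> = horner_sum (\<lambda>a. a) (length ys) (a # as) + (if c then 1 else 0)"
      using b by (auto simp: algebra_simps)
    finally show ?thesis .
  qed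
  ultimately show ?case by blast
qed (auto simp: cells_def)

text \<open>All k digits are 1 or 2, so the value lies between 2^k - 1 and 2^(k+1) - 2. Hence k is
  exactly the \<open>floor_log\<close> of the value plus 1, and the counter leaves behind a number
  of cells that depends only on the count.\<close>

lemma bijective_binary_bounds:
  assumes "fst ` set cs \<subseteq> {0, 1 :: nat}"
  shows "2 ^ length cs \<le> horner_sum (\<lambda>c. Suc (fst c)) 2 cs + 1"
    "horner_sum (\<lambda>c. Suc (fst c)) 2 cs + 1 < 2 * 2 ^ length cs"
  using assms by (induction cs) auto

section \<open>Runs through the phases of the machine\<close>

lemma reach_Count:
  assumes "i \<le> length w" "floor_log (length w + 1) \<le> B"
  shows "\<exists>cs. sweep_reach w B (Count, 0, []) (Count, Suc i, cs) \<and>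
    length cs = floor_log (i + 1) \<and> fst ` set cs \<subseteq> {0, 1} \<and>
    horner_sum (\<lambda>c. Suc (fst c)) 2 cs = i"
  using assms(1)
proof (induction i)
  case 0
  \<comment> \<open>Stepping off the left end marker counts nothing, so at input position
    \<open>Suc i\<close> exactly \<open>i\<close> letters have been counted.\<close>
  have "sweep_reach w B (Count, 0, []) (Count, Suc 0, [])"
    by (rule sweep_reach_step) (auto simp: sweep_step_def read_input_def)
  then show ?case by (intro exI[of _ "[]"]) simp
next
  case (Suc i)
  then obtain cs where cs: "sweep_reach w B (Count, 0, []) (Count, Suc i, cs)"
    "fst ` set cs \<subseteq> {0, 1}" "horner_sum (\<lambda>c. Suc (fst c)) 2 cs = i" by auto
  obtain c' cs' where r: "mealy_run pass_cell (Increment True) cs = (Increment c', cs')"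
    "fst ` set cs' \<subseteq> {0, 1}"
    "horner_sum (\<lambda>c. Suc (fst c)) 2 (cs' @ (if c' then [(0, ys ! 0)] else [])) = Suc i"
    using run_Increment_True[OF cs(2)] cs(3) by blast
  define ds where "ds = cs' @ (if c' then [(0, ys ! 0)] else [])"
  have d: "fst ` set ds \<subseteq> {0, 1}" using r(2) by (auto simp: ds_def)
  have len: "length ds = floor_log (Suc i + 1)"
    by (rule sym, rule floor_log_eqI) (use bijective_binary_bounds[OF d] r(3) in \<open>auto simp: ds_def\<close>)
  have "sweep_step w (Count, Suc i, cs) = (Count, Suc (Suc i), ds)"
    using Suc.prems r(1) by (auto simp: sweep_step_def read_input_def ds_def)
  moreover have "length ds \<le> B"
    using len floor_log_le_iff[of "Suc i + 1" "length w + 1"] Suc.prems assms(2) by linarith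
  ultimately have "sweep_reach w B (Count, Suc i, cs) (Count, Suc (Suc i), ds)"
    by (intro sweep_reach_step) auto
  with cs(1) have "sweep_reach w B (Count, 0, []) (Count, Suc (Suc i), ds)"
    by (rule sweep_reach_trans)
  with d len r(3) show ?case by (intro exI[of _ ds]) (auto simp: ds_def)
qed

lemma reach_Rewind:
  assumes "i \<le> length w + 1" "length cs \<le> B"
  shows "sweep_reach w B (Rewind, i, cs) (Read, 1, cs)"
  using assms(1)
proof (induction i)
  case 0
  then show ?case
    using assms(2) by (intro sweep_reach_step) (auto simp: sweep_step_def read_input_def run_Keep)
next
  case (Suc i)
  have "sweep_reach w B (Rewind, Suc i, cs) (Rewind, i, cs)"
    using assms(2) Suc.prems
    by (intro sweep_reach_step) (auto simp: sweep_step_def read_input_def run_Keep)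
  also have "sweep_reach w B \<dots> (Read, 1, cs)" using Suc by simp
  finally show ?case .
qed

lemma reach_Apply:
  assumes "length as = length vs" "length as \<le> B"
  shows "sweep_reach (u @ w) B (Read, Suc (length u), zip as vs)
    (Read, Suc (length u + length w), zip as (fold act w vs))"
  using assms(1)
proof (induction w arbitrary: u vs)
  case (Cons m w)
  have "sweep_reach (u @ m # w) B (Read, Suc (length u), zip as vs)
    (Read, Suc (Suc (length u)), zip as (act m vs))"
    using assms(2) Cons.prems
    by (intro sweep_reach_step) (auto simp: sweep_step_def read_input_def run_Apply act_def)
  also have "sweep_reach (u @ m # w) B \<dots>
      (Read, Suc (length u + length (m # w)), zip as (fold act (m # w) vs))"
    using Cons.IH[of "act m vs" "u @ [m]"] Cons.prems by simp
  finally show ?case .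
qed simp

lemma length_fold_act [simp]: "length (fold act w vs) = length vs"
  by (induction w arbitrary: vs) auto

definition fixes_code :: "'m list \<Rightarrow> nat list \<Rightarrow> bool" where
  "fixes_code w as \<longleftrightarrow> fold act w (map ((!) ys) as) = map ((!) ys) as"

text \<open>Induction on the distance of the current code from the end of the range: the outcome
  depends only on the codes from the current one upwards, and a successful round increases the code
  by one.\<close>

lemma reach_decision:
  assumes "set as \<subseteq> {..<length ys}" "length as \<le> B"
  shows "\<exists>i cs. sweep_reach w B (Read, 1, cells as)
    (if \<forall>as'. length as' = length as \<and> set as' \<subseteq> {..<length ys} \<and>
        horner_sum (\<lambda>a. a) (length ys) as \<le> horner_sum (\<lambda>a. a) (length ys) as' \<longrightarrow> fixes_code w as'
     then Accept else Reject, i, cs)"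
  using assms
proof (induction "length ys ^ length as - horner_sum (\<lambda>a. a) (length ys) as" arbitrary: as
    rule: less_induct)
  case less
  let ?N = "horner_sum (\<lambda>a. a) (length ys)"
  obtain c' as' where as': "mealy_run pass_cell (Check True True)
      (zip as (fold act w (map ((!) ys) as))) = (Check (fixes_code w as) c', cells as')"
    "length as' = length as" "set as' \<subseteq> {..<length ys}"
    "?N as' + (if c' then length ys ^ length as else 0) = ?N as + 1"
    using run_Check[of as "fold act w (map ((!) ys) as)" True True] less.prems(1)
    by (auto simp: fixes_code_def)
  have lt: "?N as < length ys ^ length as" by (rule horner_sum_less[OF less.prems(1)])
  have "sweep_reach w B (Read, 1, cells as)
      (Read, length w + 1, zip as (fold act w (map ((!) ys) as)))"
    using reach_Apply[of as "map ((!) ys) as" B "[]" w] less.prems(2) by (simp add: cells_def)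
  also have "sweep_reach w B \<dots> (fst (pass_end (Check (fixes_code w as) c')), length w + 1, cells as')"
    using as'(1,2) less.prems(2)
    by (intro sweep_reach_step) (auto simp: sweep_step_def read_input_def)
  finally have reach: "sweep_reach w B (Read, 1, cells as)
      (fst (pass_end (Check (fixes_code w as) c')), length w + 1, cells as')" .
  show ?case
  proof (cases "fixes_code w as")
    case False
    with reach less.prems(1) show ?thesis by auto
  next
    case ok: True
    show ?thesis
    proof (cases c')
      case True
      \<comment> \<open>The carry shows that \<open>as\<close> is the largest code; by injectivity
        of the expansion it is the only one left.\<close>
      with as'(4) lt have max: "?N as + 1 = length ys ^ length as" by simp
      have "fixes_code w bs" if bs: "length bs = length as" "set bs \<subseteq> {..<length ys}" "?N as \<le> ?N bs" for bs
      proof -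
        have "?N as = ?N bs" using horner_sum_less[OF bs(2)] bs max by simp
        then show ?thesis using horner_sum_inj[OF less.prems(1) bs(2)] bs(1) ok by simp
      qed
      with reach True ok show ?thesis by auto
    next
      case False
      with as'(4) have next_val: "?N as' = ?N as + 1" by simp
      note reach
      also have "sweep_reach w B (fst (pass_end (Check (fixes_code w as) c')), length w + 1, cells as')
          (Read, 1, cells as')"
        using False ok reach_Rewind[of "length w + 1" w "cells as'" B] as'(2) less.prems(2) by simp
      finally have reach': "sweep_reach w B (Read, 1, cells as) (Read, 1, cells as')" .
      have all_iff: "(\<forall>bs. length bs = length as \<and> set bs \<subseteq> {..<length ys} \<and> ?N as \<le> ?N bs \<longrightarrow> fixes_code w bs) \<longleftrightarrow>
        (\<forall>bs. length bs = length as' \<and> set bs \<subseteq> {..<length ys} \<and> ?N as' \<le> ?N bs \<longrightarrow> fixes_code w bs)"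
        (is "?P \<longleftrightarrow> ?P'")
      proof
        assume ?P
        show ?P' using \<open>?P\<close> next_val as'(2) by (intro allI impI) simp
      next
        assume P': ?P'
        show ?P
        proof (intro allI impI)
          fix bs assume bs: "length bs = length as \<and> set bs \<subseteq> {..<length ys} \<and> ?N as \<le> ?N bs"
          show "fixes_code w bs"
          proof (cases "?N bs = ?N as")
            case True
            have "as = bs" by (rule horner_sum_inj[OF less.prems(1)]) (use bs True in auto)
            with ok show ?thesis by blast
          next
            case False
            with P' bs next_val as'(2) show ?thesis by simp
          qed
        qed
      qed
      have "length as' \<le> B" using as'(2) less.prems(2) by simp
      moreover have "length ys ^ length as' - ?N as' < length ys ^ length as - ?N as"
        using next_val as'(2) lt by simp
      note less.hyps[OF this as'(3)]
      ultimately obtain i cs where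
        "sweep_reach w B (Read, 1, cells as')
          (if \<forall>bs. length bs = length as' \<and> set bs \<subseteq> {..<length ys} \<and> ?N as' \<le> ?N bs \<longrightarrow> fixes_code w bs
           then Accept else Reject, i, cs)" by blast
      from sweep_reach_trans[OF reach' this] show ?thesis unfolding all_iff by blast
    qed
  qed
qed

theorem fixing_words_LOGSPACE:
  "{w \<in> lists A. \<forall>vs\<in>lists (set ys). length vs = floor_log (length w + 1) \<longrightarrow> fold act w vs = vs}
    \<in> LOGSPACE A"
  (is "?L \<in> _")
  unfolding LOGSPACE_def
proof (rule sweeping_DSPACE[where s = "\<lambda>n. floor_log (n + 1)" and L = ?L])
  fix w assume w: "w \<in> lists A"
  define k where "k = floor_log (length w + 1)"
  obtain cs where cs: "sweep_reach w k (Count, 0, []) (Count, Suc (length w), cs)" "length cs = k"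
    using reach_Count[OF order_refl eq_refl[OF k_def[symmetric]]] k_def by blast
  have "sweep_reach w k (Count, 0, []) (Count, Suc (length w), cs)" by (rule cs(1))
  \<comment> \<open>\<open>Reset\<close> erases the counter. Only its length survives, and the code
    0 starts the enumeration.\<close>
  also have "sweep_reach w k \<dots> (Rewind, Suc (length w), cells (replicate k 0))"
    using cs(2) by (intro sweep_reach_step) (auto simp: sweep_step_def read_input_def run_Reset)
  also have "sweep_reach w k \<dots> (Read, 1, cells (replicate k 0))"
    by (rule reach_Rewind) auto
  finally have r: "sweep_reach w k (Count, 0, []) (Read, 1, cells (replicate k 0))" .
  have zero: "horner_sum (\<lambda>a. a) (length ys) (replicate k 0) = 0" by (induction k) auto
  have "(\<forall>as. length as = k \<and> set as \<subseteq> {..<length ys} \<longrightarrow> fixes_code w as) \<longleftrightarrow>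
    (\<forall>vs\<in>lists (set ys). length vs = k \<longrightarrow> fold act w vs = vs)"
  proof -
    \<comment> \<open>Every word over the alphabet has some code; repetitions in \<open>ys\<close>
      merely cause words to be tested several times.\<close>
    have "set ys = (!) ys ` {..<length ys}" by (auto simp: set_conv_nth)
    then have "lists (set ys) = map ((!) ys) ` {as. set as \<subseteq> {..<length ys}}"
      unfolding lists_eq_set[symmetric] by (metis lists_image)
    then show ?thesis unfolding fixes_code_def by auto
  qed
  then have "w \<in> ?L \<longleftrightarrow> (\<forall>as. length as = k \<and> set as \<subseteq> {..<length ys} \<longrightarrow> fixes_code w as)"
    using w by (simp add: k_def)
  moreover have "set (replicate k 0) \<subseteq> {..<length ys}" using two_le by auto
  from reach_decision[OF this, of k w]
  obtain i cs' where "sweep_reach w k (Read, 1, cells (replicate k 0))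
    (if \<forall>as. length as = k \<and> set as \<subseteq> {..<length ys} \<longrightarrow> fixes_code w as then Accept else Reject, i, cs')"
    unfolding zero length_replicate by auto
  ultimately have "sweep_reach w k (Count, 0, []) (if w \<in> ?L then Accept else Reject, i, cs')"
    using sweep_reach_trans[OF r] by presburger
  then show "\<exists>i cs. sweep_reach w (floor_log (length w + 1)) (Count, 0, [])
      (if w \<in> ?L then Accept else Reject, i, cs)"
    unfolding k_def by blast
next
  show "(\<lambda>n. real (floor_log (n + 1) + 2)) \<in> O(\<lambda>n. ln (real n))"
    by (rule floor_log_bigo_ln)
qed auto

end

section \<open>Contracting groups\<close>

lemma tree_aut_image:
  assumes "g \<in> carrier (tree_aut X)" "v \<in> lists X"
  shows "g v \<in> lists X" "length (g v) = length v"
  using tree_aut_append[OF assms(1) lists.Nil assms(2)] tree_autD(2)[OF assms(1)] by auto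

lemma tree_aut_eqI:
  assumes "g \<in> carrier (tree_aut X)" "h \<in> carrier (tree_aut X)" "\<And>v. v \<in> lists X \<Longrightarrow> g v = h v"
  shows "g = h"
proof
  fix v show "g v = h v"
  proof (cases "v \<in> lists X")
    case False
    then show ?thesis
      using permutes_not_in[OF tree_autD(1)[OF assms(1)]] permutes_not_in[OF tree_autD(1)[OF assms(2)]]
      by simp
  qed (rule assms(3))
qed

lemma comp_in_tree_aut:
  "g \<in> carrier (tree_aut X) \<Longrightarrow> h \<in> carrier (tree_aut X) \<Longrightarrow> h \<circ> g \<in> carrier (tree_aut X)"
  using monoid.m_closed[OF group.is_monoid[OF group_tree_aut], where x = g and y = h] by (simp add: tree_aut_def)

lemma id_in_tree_aut: "id \<in> carrier (tree_aut X)"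
  by (simp add: tree_aut_def permutes_id)

lemma states_Nil [simp]: "states X g [] = g"
  and states_Cons [simp]: "states X g (x # v) = states X (state X g x) v"
  and states_append: "states X g (u @ v) = states X (states X g u) v"
  by (simp_all add: states_def)

lemma states_closed:
  "g \<in> carrier (tree_aut X) \<Longrightarrow> v \<in> lists X \<Longrightarrow> states X g v \<in> carrier (tree_aut X)"
  by (induction v arbitrary: g) (auto simp: state_closed)

lemma states_in:
  "self_similar X G \<Longrightarrow> g \<in> G \<Longrightarrow> v \<in> lists X \<Longrightarrow> states X g v \<in> G"
  by (induction v arbitrary: g) (auto simp: self_similar_def)

lemma tree_aut_append_states:
  assumes "g \<in> carrier (tree_aut X)" "v \<in> lists X" "w \<in> lists X"
  shows "g (v @ w) = g v @ states X g v w"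
  using assms(2,1)
proof (induction v arbitrary: g)
  case Nil
  then show ?case by (simp add: tree_autD(2))
next
  case (Cons x v)
  then have "g (x # v @ w) = g [x] @ state X g x (v @ w)"
    using assms(3) by (intro tree_aut_Cons(1)) auto
  also have "state X g x (v @ w) = state X g x v @ states X (state X g x) v w"
    using Cons by (intro Cons.IH state_closed)
  also have "g [x] @ \<dots> = g (x # v) @ states X g (x # v) w"
    using tree_aut_Cons(1)[OF Cons.prems Cons.hyps(1,2)] by simp
  finally show ?case by simp
qed

lemma states_id:
  assumes "v \<in> lists X"
  shows "states X id v = id"
proof (rule tree_aut_eqI[of _ X])
  show "states X id v w = id w" if "w \<in> lists X" for w
    using tree_aut_append_states[OF id_in_tree_aut assms that] by simp
qed (rule states_closed id_in_tree_aut assms)+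

text \<open>The rule (gh)@v = (g@v)(h@(v^g)) for the right action, in which
  \<open>h \<circ> g\<close> is the product of \<open>g\<close> and \<open>h\<close> in this
  order.\<close>

lemma states_comp:
  assumes "g \<in> carrier (tree_aut X)" "h \<in> carrier (tree_aut X)" "v \<in> lists X"
  shows "states X (h \<circ> g) v = states X h (g v) \<circ> states X g v"
proof (rule tree_aut_eqI[of _ X])
  note gv = tree_aut_image[OF assms(1,3)]
  show "states X (h \<circ> g) v \<in> carrier (tree_aut X)"
    "states X h (g v) \<circ> states X g v \<in> carrier (tree_aut X)"
    using assms gv by (auto intro!: comp_in_tree_aut states_closed)
  show "states X (h \<circ> g) v w = (states X h (g v) \<circ> states X g v) w" if w: "w \<in> lists X" for w
  proof -
    have "(h \<circ> g) v @ states X (h \<circ> g) v w = (h \<circ> g) (v @ w)"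
      using assms w by (intro tree_aut_append_states[symmetric] comp_in_tree_aut)
    also have "\<dots> = h (g v @ states X g v w)"
      using tree_aut_append_states[OF assms(1,3) w] by simp
    also have "\<dots> = (h \<circ> g) v @ (states X h (g v) \<circ> states X g v) w"
      using tree_aut_append_states[OF assms(2) gv(1) tree_aut_image(1)[OF states_closed[OF assms(1,3)] w]]
      by simp
    finally show ?thesis by simp
  qed
qed

text \<open>The first letter acts first, which is the order in which the machine reads its
  input.\<close>

lemma word_value_Nil [simp]: "word_value (tree_aut X) [] = id"
  and word_value_Cons [simp]:
    "word_value (tree_aut X) (g # w) = word_value (tree_aut X) w \<circ> g"
  by (simp_all add: word_value_def tree_aut_def)

lemma word_value_closed:
  "w \<in> lists (carrier (tree_aut X)) \<Longrightarrow> word_value (tree_aut X) w \<in> carrier (tree_aut X)"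
proof (induction w rule: lists.induct)
  case Nil
  show ?case unfolding word_value_Nil by (rule id_in_tree_aut)
next
  case (Cons g w)
  then show ?case unfolding word_value_Cons by (intro comp_in_tree_aut)
qed

lemma concat_eq_iff_same_lengths:
  "map length xs = map length ys \<Longrightarrow> concat xs = concat ys \<longleftrightarrow> xs = ys"
proof (induction xs arbitrary: ys)
  case (Cons x xs)
  then show ?case by (cases ys) auto
qed simp

lemma blocks_exist:
  "v \<in> lists X \<Longrightarrow> length v = k * c \<Longrightarrow>
    \<exists>vs\<in>lists {y \<in> lists X. length y = c}. length vs = k \<and> concat vs = v"
proof (induction k arbitrary: v)
  case (Suc k)
  have "set (drop c v) \<subseteq> set v" "set (take c v) \<subseteq> set v"
    by (rule set_drop_subset set_take_subset)+
  then have d: "drop c v \<in> lists X" "take c v \<in> lists X" using Suc.prems(1) by auto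
  with Suc.IH[of "drop c v"] Suc.prems(2) obtain vs where
    "vs \<in> lists {y \<in> lists X. length y = c}" "length vs = k" "concat vs = drop c v" by auto
  with d Suc.prems(2) show ?case by (intro bexI[of _ "take c v # vs"]) auto
qed auto

text \<open>A letter of the transducer is a whole block of tree letters: \<open>g\<close> outputs
  the image of the block and goes on as its state there. The block lengths may vary, and the empty
  block leaves \<open>g\<close> unchanged.\<close>

definition block_step :: "'x set \<Rightarrow> ('x list \<Rightarrow> 'x list) \<Rightarrow> 'x list \<Rightarrow> ('x list \<Rightarrow> 'x list) \<times> 'x list" where
  "block_step X g y = (states X g y, g y)"

lemma block_run:
  assumes "g \<in> carrier (tree_aut X)" "vs \<in> lists (lists X)"
  shows "concat (snd (mealy_run (block_step X) g vs)) = g (concat vs)"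
    "map length (snd (mealy_run (block_step X) g vs)) = map length vs"
    "snd (mealy_run (block_step X) g vs) \<in> lists (lists X)"
  using assms(2,1)
proof (induction vs arbitrary: g)
  case (Cons v vs)
  have c: "concat vs \<in> lists X" using Cons.hyps(2) by (auto simp: in_lists_conv_set)
  {
    case 1
    then show ?case
      using Cons.IH(1)[OF states_closed[OF 1 Cons.hyps(1)]]
        tree_aut_append_states[OF 1 Cons.hyps(1) c]
      by (simp add: block_step_def split_beta Let_def)
  next
    case 2
    then show ?case
      using Cons.IH(2)[OF states_closed[OF 2 Cons.hyps(1)]] tree_aut_image(2)[OF 2 Cons.hyps(1)]
      by (simp add: block_step_def split_beta Let_def)
  next
    case 3
    then show ?case
      using Cons.IH(3)[OF states_closed[OF 3 Cons.hyps(1)]] tree_aut_image(1)[OF 3 Cons.hyps(1)]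
      by (simp add: block_step_def split_beta Let_def)
  }
qed (auto simp: tree_autD)

text \<open>The action preserves every block length, so a list of blocks can be recovered from its
  concatenation.\<close>

lemma fold_block_run:
  assumes "w \<in> lists (carrier (tree_aut X))" "vs \<in> lists (lists X)"
  shows "fold (\<lambda>g us. snd (mealy_run (block_step X) g us)) w vs = vs \<longleftrightarrow>
    word_value (tree_aut X) w (concat vs) = concat vs"
proof -
  let ?f = "fold (\<lambda>g us. snd (mealy_run (block_step X) g us)) w"
  have "concat (?f vs) = word_value (tree_aut X) w (concat vs) \<and> map length (?f vs) = map length vs"
    using assms
  proof (induction w arbitrary: vs rule: lists.induct)
    case (Cons g w)
    then show ?case using block_run[OF Cons.hyps(1) Cons.prems] by auto
  qed simp
  then show ?thesis using concat_eq_iff_same_lengths by metis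
qed

text \<open>Fixing a vertex forces fixing all its prefixes, so every extension of a moved vertex is
  moved. A moved vertex is not the root, hence there is a letter to extend it with.\<close>

lemma moved_at_deep_levels:
  assumes g: "g \<in> carrier (tree_aut X)" "g \<noteq> id"
  shows "\<exists>n. \<forall>l\<ge>n. \<exists>v\<in>lists X. length v = l \<and> g v \<noteq> v"
proof -
  obtain u where u: "u \<in> lists X" "g u \<noteq> u"
    using tree_aut_eqI[OF g(1) id_in_tree_aut] g(2) by auto
  then have "u \<noteq> []" using tree_autD(2)[OF g(1)] by auto
  then obtain x where x: "x \<in> X" using u(1) by (cases u) auto
  show ?thesis
  proof (intro exI[of _ "length u"] allI impI)
    fix l assume l: "length u \<le> l"
    let ?w = "replicate (l - length u) x"
    have "?w \<in> lists X" using x by (auto simp: in_lists_conv_set)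
    then have "g (u @ ?w) \<noteq> u @ ?w" "u @ ?w \<in> lists X"
      using tree_aut_append_states[OF g(1) u(1)] tree_aut_image(2)[OF g(1) u(1)] u by auto
    with l show "\<exists>v\<in>lists X. length v = l \<and> g v \<noteq> v" by (intro bexI[of _ "u @ ?w"]) auto
  qed
qed

text \<open>The set \<open>Q\<close> consists of all states of the generators and of a finite set \<open>N\<close> witnessing that
  the group is contracting; products of two of its elements fall back into it at depth \<open>d\<close>.\<close>

locale contracting_set =
  fixes X :: "'x set" and Q :: "('x list \<Rightarrow> 'x list) set" and d :: nat
  assumes Q_carrier: "Q \<subseteq> carrier (tree_aut X)"
    and Q_states: "g \<in> Q \<Longrightarrow> v \<in> lists X \<Longrightarrow> states X g v \<in> Q"
    and Q_comp: "g \<in> Q \<Longrightarrow> h \<in> Q \<Longrightarrow> v \<in> lists X \<Longrightarrow> d \<le> length v \<Longrightarrow> states X (h \<circ> g) v \<in> Q"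
    and Q_moves: "g \<in> Q \<Longrightarrow> g \<noteq> id \<Longrightarrow> d \<le> l \<Longrightarrow> \<exists>v\<in>lists X. length v = l \<and> g v \<noteq> v"
begin

lemma Q_word: "w \<in> lists Q \<Longrightarrow> w \<in> lists (carrier (tree_aut X))"
  using Q_carrier by auto

text \<open>The first two letters merge into the single element
  \<open>states X (b \<circ> a) v\<close> of \<open>Q\<close>. The rest is treated at the image of
  \<open>v\<close>, which has the same length; a last unpaired letter is replaced by its own
  state.\<close>

lemma states_word_halves:
  assumes "w \<in> lists Q" "length w \<le> 2 * m" "v \<in> lists X" "d \<le> length v"
  shows "\<exists>w'\<in>lists Q. length w' \<le> m \<and>
    states X (word_value (tree_aut X) w) v = word_value (tree_aut X) w'"
  using assms
proof (induction m arbitrary: w v)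
  case 0
  then show ?case by (intro bexI[of _ "[]"]) (auto simp: states_id[unfolded id_def])
next
  case (Suc m)
  consider "w = []" | a where "w = [a]" | a b u where "w = a # b # u"
    by (metis list.exhaust)
  then show ?case
  proof cases
    case 1
    then show ?thesis using Suc.prems by (intro bexI[of _ "[]"]) (auto simp: states_id[unfolded id_def])
  next
    case 2
    then show ?thesis using Suc.prems Q_states by (intro bexI[of _ "[states X a v]"]) auto
  next
    case 3
    then have ab: "a \<in> Q" "b \<in> Q" "u \<in> lists Q" using Suc.prems(1) by auto
    have c: "b \<circ> a \<in> carrier (tree_aut X)" using ab Q_carrier by (intro comp_in_tree_aut) auto
    note im = tree_aut_image[OF c Suc.prems(3)]
    from Suc.IH[OF ab(3) _ im(1)] im(2) Suc.prems(2,4) 3 obtain u' where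
      u': "u' \<in> lists Q" "length u' \<le> m"
      "states X (word_value (tree_aut X) u) ((b \<circ> a) v) = word_value (tree_aut X) u'" by auto
    have "states X (word_value (tree_aut X) w) v =
        states X (word_value (tree_aut X) u \<circ> (b \<circ> a)) v"
      using 3 by (simp add: o_assoc)
    also have "\<dots> = word_value (tree_aut X) (states X (b \<circ> a) v # u')"
      using states_comp[OF c word_value_closed[OF Q_word[OF ab(3)]] Suc.prems(3)] u'(3) by simp
    finally show ?thesis
      using u'(1,2) Q_comp[OF ab(1,2) Suc.prems(3,4)] by (intro bexI[of _ "states X (b \<circ> a) v # u'"]) auto
  qed
qed

text \<open>Descending \<open>d\<close> levels halves the length of a word, so that a word of length at most \<open>2 ^ K\<close>
  is reduced to single elements of \<open>Q\<close> at depth \<open>d * K\<close>.\<close>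

lemma word_value_eq_id:
  assumes "w \<in> lists Q" "length w \<le> 2 ^ K" "d * (K + 1) \<le> l"
    and "\<And>v. v \<in> lists X \<Longrightarrow> length v = l \<Longrightarrow> word_value (tree_aut X) w v = v"
  shows "word_value (tree_aut X) w = id"
  using assms
proof (induction K arbitrary: w l)
  case 0
  \<comment> \<open>This is where the extra \<open>d\<close> in \<open>d * (K + 1)\<close> is spent:
    a nontrivial element of \<open>Q\<close> moves some vertex on every level from \<open>d\<close>
    on.\<close>
  then consider "w = []" | a where "w = [a]" "a \<in> Q" by (cases w) auto
  then show ?case
  proof cases
    case 2
    then show ?thesis using 0 Q_moves[of a l] by force
  qed simp
next
  case (Suc K)
  let ?g = "word_value (tree_aut X) w"
  have g: "?g \<in> carrier (tree_aut X)" using Suc.prems(1) by (intro word_value_closed Q_word)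
  have fixed: "?g v = v \<and> states X ?g v w' = w'"
    if "v \<in> lists X" "length v = d" "w' \<in> lists X" "length w' = l - d" for v w'
  proof -
    have "?g v @ states X ?g v w' = v @ w'"
      using tree_aut_append_states[OF g that(1,3)] Suc.prems(3) Suc.prems(4)[of "v @ w'"] that by auto
    then show ?thesis using tree_aut_image(2)[OF g that(1)] by simp
  qed
  have triv: "states X ?g v = id" if v: "v \<in> lists X" "length v = d" for v
  proof -
    from states_word_halves[OF Suc.prems(1) _ v(1), of "2 ^ K"] Suc.prems(2) v(2)
    obtain w' where w': "w' \<in> lists Q" "length w' \<le> 2 ^ K" "states X ?g v = word_value (tree_aut X) w'"
      by auto
    have "d * (K + 1) \<le> l - d" using Suc.prems(3) by (simp add: algebra_simps)
    then have "word_value (tree_aut X) w' = id"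
      by (rule Suc.IH[OF w'(1,2)]) (use fixed[OF v] w'(3) in auto)
    then show ?thesis unfolding w'(3) .
  qed
  show ?case
  proof (rule tree_aut_eqI[OF g id_in_tree_aut])
    fix u assume u: "u \<in> lists X"
    show "?g u = id u"
    proof (cases "X = {}")
      case True
      then show ?thesis using u tree_autD(2)[OF g] by auto
    next
      case False
      then obtain x where x: "x \<in> X" by auto
      have rep: "replicate n x \<in> lists X" for n using x by (auto simp: in_lists_conv_set)
      \<comment> \<open>A vertex \<open>u\<close> above level \<open>d\<close> has no prefix of
        length \<open>d\<close>. It is padded, and fixing the padded vertex fixes
        \<open>u\<close>.\<close>
      define p where "p = u @ replicate d x"
      have p: "p \<in> lists X" "take d p \<in> lists X" "drop d p \<in> lists X" "length (take d p) = d"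
        using u x by (auto simp: p_def in_lists_conv_set dest: in_set_takeD in_set_dropD)
      have "?g p = ?g (take d p) @ states X ?g (take d p) (drop d p)"
        using tree_aut_append_states[OF g p(2,3)] by simp
      also have "\<dots> = p" using fixed[OF p(2,4) rep] triv[OF p(2,4)] by simp
      finally have "?g u @ states X ?g u (replicate d x) = u @ replicate d x"
        using tree_aut_append_states[OF g u rep] by (simp add: p_def)
      then show ?thesis using tree_aut_image(2)[OF g u] by simp
    qed
  qed
qed

end

text \<open>Every element of \<open>G\<close> has finitely many states: those at long vertices lie
  in \<open>N\<close>, and there are finitely many short vertices as \<open>X\<close> is finite. So
  \<open>Q\<close> is finite, and \<open>d\<close> can be the maximum of finitely many thresholds,
  one for each pair and one for each element.\<close>

lemma contracting_set_exists:
  assumes "finite X" "self_similar X G" "contracting X G" "finite A" "A \<subseteq> G"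
  obtains Q d where "finite Q" "A \<subseteq> Q" "contracting_set X Q d"
proof -
  have sub: "subgroup G (tree_aut X)" using assms(2) by (simp add: self_similar_def)
  have G: "G \<subseteq> carrier (tree_aut X)" using subgroup.subset[OF sub] .
  have comp: "h \<circ> g \<in> G" if "g \<in> G" "h \<in> G" for g h
    using subgroup.m_closed[OF sub that] by (simp add: tree_aut_def)
  obtain N where N: "finite N" "N \<subseteq> G"
    "\<And>g. g \<in> G \<Longrightarrow> \<exists>n. \<forall>v\<in>lists X. length v \<ge> n \<longrightarrow> states X g v \<in> N"
    using assms(3) unfolding contracting_def by blast
  have fin: "finite (states X g ` lists X)" if g: "g \<in> G" for g
  proof -
    obtain n where n: "\<forall>v\<in>lists X. length v \<ge> n \<longrightarrow> states X g v \<in> N" using N(3)[OF g] by blast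
    have "states X g ` lists X \<subseteq> N \<union> states X g ` {v. set v \<subseteq> X \<and> length v \<le> n}"
    proof
      fix h assume "h \<in> states X g ` lists X"
      then obtain v where v: "v \<in> lists X" "h = states X g v" by blast
      show "h \<in> N \<union> states X g ` {v. set v \<subseteq> X \<and> length v \<le> n}"
        using n v by (cases "n \<le> length v") auto
    qed
    then show ?thesis
      using N(1) finite_lists_length_le[OF assms(1), of n] by (blast intro: finite_subset)
  qed
  define Q where "Q = (\<Union>g\<in>A \<union> N. states X g ` lists X)"
  have A_N: "A \<union> N \<subseteq> Q"
  proof
    fix g assume "g \<in> A \<union> N"
    then show "g \<in> Q" unfolding Q_def by (intro UN_I[of g] image_eqI[of _ _ "[]"]) auto
  qed
  have finQ: "finite Q" unfolding Q_def using assms(4,5) N(1,2) fin by blast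
  have QG: "Q \<subseteq> G" using states_in[OF assms(2)] assms(5) N(2) by (auto simp: Q_def)
  have "\<exists>n. \<forall>v\<in>lists X. length v \<ge> n \<longrightarrow> states X (h \<circ> g) v \<in> Q" if "g \<in> Q" "h \<in> Q" for g h
  proof -
    have "g \<in> G" "h \<in> G" using that QG by auto
    from N(3)[OF comp[OF this]] A_N show ?thesis by blast
  qed
  then obtain e where e: "\<And>g h v. g \<in> Q \<Longrightarrow> h \<in> Q \<Longrightarrow> v \<in> lists X \<Longrightarrow> e g h \<le> length v \<Longrightarrow>
      states X (h \<circ> g) v \<in> Q" by metis
  have "\<exists>n. g \<noteq> id \<longrightarrow> (\<forall>l\<ge>n. \<exists>v\<in>lists X. length v = l \<and> g v \<noteq> v)" if "g \<in> Q" for g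
    using moved_at_deep_levels[of g X] that QG G by blast
  then obtain c where c: "\<And>g l. g \<in> Q \<Longrightarrow> g \<noteq> id \<Longrightarrow> c g \<le> l \<Longrightarrow> \<exists>v\<in>lists X. length v = l \<and> g v \<noteq> v"
    by metis
  define d where "d = Max (insert 0 (case_prod e ` (Q \<times> Q) \<union> c ` Q))"
  have fin_d: "finite (insert 0 (case_prod e ` (Q \<times> Q) \<union> c ` Q))" using finQ by simp
  have de: "e g h \<le> d" if "g \<in> Q" "h \<in> Q" for g h
    unfolding d_def by (rule Max_ge[OF fin_d]) (use that in force)
  have dc: "c g \<le> d" if "g \<in> Q" for g
    unfolding d_def by (rule Max_ge[OF fin_d]) (use that in force)
  have "contracting_set X Q d"
  proof
    show "Q \<subseteq> carrier (tree_aut X)" using QG G by blast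
    show "states X g v \<in> Q" if g: "g \<in> Q" and v: "v \<in> lists X" for g v
    proof -
      obtain h u where "h \<in> A \<union> N" "u \<in> lists X" "g = states X h u" using g by (auto simp: Q_def)
      with v show ?thesis
        unfolding Q_def by (intro UN_I[of h] image_eqI[of _ _ "u @ v"]) (auto simp: states_append)
    qed
    show "states X (h \<circ> g) v \<in> Q" if "g \<in> Q" "h \<in> Q" "v \<in> lists X" "d \<le> length v" for g h v
      using e[OF that(1-3)] de[OF that(1,2)] that(4) by simp
    show "\<exists>v\<in>lists X. length v = l \<and> g v \<noteq> v" if "g \<in> Q" "g \<noteq> id" "d \<le> l" for g l
      using c[OF that(1,2)] dc[OF that(1)] that(3) by simp
  qed
  with finQ A_N that show thesis by blast
qed

theorem proposition5:
  fixes X :: "'x set" and G S :: "('x list \<Rightarrow> 'x list) set"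
  assumes "finite X"
    and "self_similar X G"
    and "contracting X G"
    and "finite S"
    and "generate (tree_aut X) S = G"
  shows "word_problem (tree_aut X) S \<in> LOGSPACE (standard_gens (tree_aut X) S)"
proof -
  define A where "A = standard_gens (tree_aut X) S"
  have "A \<subseteq> G"
    unfolding A_def standard_gens_def assms(5)[symmetric]
    by (auto intro: generate.incl generate.inv generate.one)
  moreover have "finite A" using assms(4) by (simp add: A_def standard_gens_def)
  ultimately obtain Q d where Q: "finite Q" "A \<subseteq> Q" "contracting_set X Q d"
    using contracting_set_exists[OF assms(1-3)] by blast
  interpret contracting_set X Q d by (rule Q(3))
  \<comment> \<open>With k cells the word has length at most 2^(k+1), so level
    \<open>d * (k + 2)\<close> is deep enough; for k at least 1 this is at most
    \<open>3 * d * k\<close>, the level reached by k blocks of length \<open>3 * d\<close>.\<close>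
  define Y where "Y = {y \<in> lists X. length y \<le> 3 * d}"
  have "finite Y"
    using finite_lists_length_le[OF assms(1), of "3 * d"] by (simp add: Y_def lists_eq_set)
  then obtain zs where zs: "set zs = Y" using finite_list by blast
  \<comment> \<open>The two copies of the empty block keep the base at least 2 even when
    \<open>X\<close> is empty or \<open>d = 0\<close>. This is why \<open>Y\<close> also admits
    blocks shorter than \<open>3 * d\<close>; testing those is harmless, since the identity fixes
    every vertex.\<close>
  define ys where "ys = [] # [] # zs"
  have ys: "set ys = Y" using zs by (auto simp: ys_def Y_def)
  interpret transducer A Q "block_step X" ys
  proof
    show "block_step X g y \<in> Q \<times> set ys" if "g \<in> Q" "y \<in> set ys" for g y
    proof -
      have gy: "g \<in> carrier (tree_aut X)" "y \<in> lists X" using that Q_carrier by (auto simp: ys Y_def)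
      show ?thesis using that Q_states tree_aut_image[OF gy] by (simp add: block_step_def ys Y_def)
    qed
  qed (use Q in \<open>simp_all add: ys_def\<close>)
  have "word_value (tree_aut X) w = id \<longleftrightarrow>
      (\<forall>vs\<in>lists (set ys). length vs = floor_log (length w + 1) \<longrightarrow> fold act w vs = vs)"
    if w: "w \<in> lists A" for w
  proof -
    define k where "k = floor_log (length w + 1)"
    have wQ: "w \<in> lists Q" using w Q(2) by auto
    have act: "fold act w vs = vs \<longleftrightarrow> word_value (tree_aut X) w (concat vs) = concat vs"
      if "vs \<in> lists Y" for vs
    proof -
      have "vs \<in> lists (lists X)" using that by (auto simp: Y_def)
      then show ?thesis using fold_block_run[OF Q_word[OF wQ]] by (simp add: act_def[abs_def])
    qed
    have "word_value (tree_aut X) w = id" if fixed: "\<forall>vs\<in>lists Y. length vs = k \<longrightarrow> fold act w vs = vs"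
    \<comment> \<open>The empty word leaves no cells, so k = 0 and the depth estimate fails, but its
      value is \<open>id\<close>.\<close>
    proof (cases "w = []")
      case False
      then have "2 ^ 1 \<le> length w + 1" by (cases w) auto
      then have "1 \<le> k" unfolding k_def by (metis floor_log_le_iff floor_log_power)
      show ?thesis
      proof (rule word_value_eq_id[OF wQ])
        show "length w \<le> 2 ^ (k + 1)"
          using floor_log_exp2_ge[of "length w + 1"] by (simp add: k_def)
        have "d * (k + 2) \<le> d * (3 * k)" using \<open>1 \<le> k\<close> by (intro mult_le_mono2) simp
        then show "d * (k + 1 + 1) \<le> k * (3 * d)" by (simp add: mult_ac)
        fix v assume v: "v \<in> lists X" "length v = k * (3 * d)"
        then obtain vs where vs: "vs \<in> lists {y \<in> lists X. length y = 3 * d}" "length vs = k" "concat vs = v"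
          using blocks_exist[OF v] by blast
        have vsY: "vs \<in> lists Y" using vs(1) by (auto simp: Y_def)
        with fixed vs(2) have "fold act w vs = vs" by blast
        then show "word_value (tree_aut X) w v = v" unfolding act[OF vsY] vs(3) .
      qed
    qed simp
    moreover have "fold act w vs = vs" if "word_value (tree_aut X) w = id" "vs \<in> lists Y" for vs
      using act that by simp
    ultimately show ?thesis unfolding ys k_def by blast
  qed
  then have "word_problem (tree_aut X) S =
    {w \<in> lists A. \<forall>vs\<in>lists (set ys). length vs = floor_log (length w + 1) \<longrightarrow> fold act w vs = vs}"
    unfolding word_problem_def A_def[symmetric] by (auto simp: tree_aut_def)
  then show ?thesis
    using fixing_words_LOGSPACE by (simp add: A_def)
qed

end
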